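(* Let $q$ be a prime power, $n\ge 1$, $\mathbf t=(t_1,\ldots,t_n)$ indeterminates, and let $f(\mathbf t)=\sum_{\mathbf i\in\mathbb N^n}a(\mathbf i)\mathbf t^{\mathbf i}\in\mathbb F_q[[\mathbf t]]$ be algebraic over $\mathbb F_q(\mathbf t)$ with degree $d$, total height $h$, and partial height $(h_1,\ldots,h_n)$. Let $\mathbf a=(a(\mathbf i))_{\mathbf i\in\mathbb N^n}$. Set $$N:=d\cdot\min\left\{\prod_{i=1}^n(h_i+1),\ \binom{n+h}{n}\right\}\quad\text{and}\quad N':=(d+1)\cdot\min\left\{\prod_{i=1}^n(h_i+1),\ \binom{n+h}{n}\right\}.$$ Then $$\overleftarrow{\mathrm{comp}}_q(\mathbf a)\le 1+q^{N}\qquad\text{and}\qquad\overrightarrow{\mathrm{comp}}_q(\mathbf a)\le q^{N'}.$$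
   Context: $\mathbb N=\{0,1,2,\ldots\}$; $\mathbf t^{\mathbf i}=t_1^{i_1}\cdots t_n^{i_n}$. Degree and heights: the degree of $f$ is $d=[\mathbb F_q(\mathbf t)(f):\mathbb F_q(\mathbf t)]$; $h_i$ is the minimal degree in $t_i$ of a nonzero polynomial $A(\mathbf t,y)\in\mathbb F_q[\mathbf t,y]$ with $A(\mathbf t,f)=0$; $h$ is the minimal total degree in $\mathbf t$ of a nonzero polynomial $A(\mathbf t,y)\in\mathbb F_q[\mathbf t,y]$ with $A(\mathbf t,f)=0$. State complexity: a $q$-automaton here is a deterministic finite automaton with output, with input alphabet $\{0,\ldots,q-1\}^n$. A multi-index $\mathbf i=(i_1,\ldots,i_n)$ is fed to it through the base-$q$ expansions of $i_1,\ldots,i_n$, padded with leading zeros to a common length and read simultaneously digit by digit; the automaton generates $\mathbf a$ if, for every $\mathbf i$ (and every such padded expansion), its output after reading the input is $a(\mathbf i)$. In reverse reading the digits are read starting from the least significant ones; in direct reading, from the most significant ones. $\overleftarrow{\mathrm{comp}}_q(\mathbf a)$ (resp. $\overrightarrow{\mathrm{comp}}_q(\mathbf a)$) is the number of states in a minimal finite automaton generating $\mathbf a$ in reverse (resp. direct) reading. *)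

theory Defs
  imports
    "HOL-Analysis.Finite_Cartesian_Product"
    "HOL-Algebra.Finite_Extensions"
    "HOL-Algebra.Generated_Fields"
    "HOL-Algebra.Algebraic_Closure_Type"
    "HOL-Computational_Algebra.Fraction_Field"
    "HOL-Library.Poly_Mapping"
    "HOL-Library.Extended_Nat"
begin

no_notation fps_nth (infixl \<open>$\<close> 75)

section \<open>Multivariate formal power series\<close>

text \<open>
  The number of variables is \<open>CARD('n)\<close>, and multi-indices are elements of the type \<open>nat ^ 'n\<close>.
\<close>

typedef ('a, 'n) mfps = "UNIV :: (nat ^ 'n \<Rightarrow> 'a) set"
  morphisms mfps_nth Abs_mfps
  by simp

setup_lifting type_definition_mfps

lemma mfps_eqI: "(\<And>i. mfps_nth f i = mfps_nth g i) \<Longrightarrow> f = g"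
  by transfer auto

lemma mfps_nth_Abs [simp]: "mfps_nth (Abs_mfps a) = a"
  by (simp add: Abs_mfps_inverse)

lemma finite_vec_decompositions: "finite {(i :: nat ^ 'n::finite, j). i + j = k}"
proof -
  let ?B = "{i :: nat ^ 'n. \<forall>x. i $ x \<le> k $ x}"
  have "finite (($) ` ?B)"
    by (rule finite_subset[of _ "PiE UNIV (\<lambda>x. {..k $ x})"]) (auto intro: finite_PiE)
  then have "finite ?B"
    by (rule finite_imageD) (auto simp: inj_on_def vec_eq_iff)
  then have "finite (?B \<times> ?B)"
    by blast
  moreover have "{(i :: nat ^ 'n, j). i + j = k} \<subseteq> ?B \<times> ?B"
    by auto
  ultimately show ?thesis
    by (rule finite_subset[rotated])
qed

instantiation mfps :: (comm_ring_1, finite) comm_ring_1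
begin

lift_definition zero_mfps :: "('a, 'b) mfps" is "\<lambda>_. 0" .
lift_definition one_mfps :: "('a, 'b) mfps" is "\<lambda>i. if i = 0 then 1 else 0" .
lift_definition plus_mfps :: "('a, 'b) mfps \<Rightarrow> ('a, 'b) mfps \<Rightarrow> ('a, 'b) mfps"
  is "\<lambda>f g i. f i + g i" .
lift_definition uminus_mfps :: "('a, 'b) mfps \<Rightarrow> ('a, 'b) mfps" is "\<lambda>f i. - f i" .
lift_definition minus_mfps :: "('a, 'b) mfps \<Rightarrow> ('a, 'b) mfps \<Rightarrow> ('a, 'b) mfps"
  is "\<lambda>f g i. f i - g i" .
lift_definition times_mfps :: "('a, 'b) mfps \<Rightarrow> ('a, 'b) mfps \<Rightarrow> ('a, 'b) mfps"
  is "\<lambda>f g k. \<Sum>(i, j) | i + j = k. f i * g j" .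

instance
proof
  fix f g h :: "('a, 'b) mfps"
  show "f + g + h = f + (g + h)" "f + g = g + f" "0 + f = f" "- f + f = 0" "f - g = f + - g"
    by (transfer; auto simp: algebra_simps)+
  show "(0 :: ('a, 'b) mfps) \<noteq> 1"
    by transfer (auto simp: fun_eq_iff)
  show "f * g = g * f"
  proof (transfer, rule ext)
    fix f g :: "nat ^ 'b \<Rightarrow> 'a" and k
    show "(\<Sum>(i, j) | i + j = k. f i * g j) = (\<Sum>(i, j) | i + j = k. g i * f j)"
      by (rule sum.reindex_bij_witness[of _ prod.swap prod.swap]) (auto simp: algebra_simps)
  qed
  show "(f + g) * h = f * h + g * h"
    by transfer (auto simp: algebra_simps sum.distrib split_def)
  show "1 * f = f"
  proof (transfer, rule ext)
    fix f :: "nat ^ 'b \<Rightarrow> 'a" and k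
    have "(\<Sum>(i, j) | i + j = k. (if i = 0 then 1 else 0) * f j) =
          (\<Sum>(i, j) \<in> {(0 :: nat ^ 'b, k)}. (if i = 0 then 1 else 0) * f j)"
      by (rule sum.mono_neutral_right) (auto simp: finite_vec_decompositions split: if_splits)
    then show "(\<Sum>(i, j) | i + j = k. (if i = 0 then 1 else 0) * f j) = f k"
      by simp
  qed
  show "f * g * h = f * (g * h)"
  proof (transfer, rule ext)
    fix f g h :: "nat ^ 'b \<Rightarrow> 'a" and k
    have "(\<Sum>(u, c) | u + c = k. (\<Sum>(i, j) | i + j = u. f i * g j) * h c) =
          (\<Sum>x | fst x + snd x = k.
             \<Sum>y | fst y + snd y = fst x. f (fst y) * g (snd y) * h (snd x))"
      by (simp add: split_def sum_distrib_right)
    also have "\<dots> = (\<Sum>(x, y) \<in> (SIGMA x:{x. fst x + snd x = k}. {y. fst y + snd y = fst x}).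
                      f (fst y) * g (snd y) * h (snd x))"
      using finite_vec_decompositions by (subst sum.Sigma) (auto simp: split_def)
    also have "\<dots> = (\<Sum>(x, y) \<in> (SIGMA x:{x. fst x + snd x = k}. {y. fst y + snd y = snd x}).
                      f (fst x) * (g (fst y) * h (snd y)))"
      by (rule sum.reindex_bij_witness[of _
            "\<lambda>(x, y). ((fst x + fst y, snd y), (fst x, fst y))"
            "\<lambda>(x, y). ((fst y, snd y + snd x), (snd y, snd x))"])
         (auto simp: algebra_simps)
    also have "\<dots> = (\<Sum>x | fst x + snd x = k.
             \<Sum>y | fst y + snd y = snd x. f (fst x) * (g (fst y) * h (snd y)))"
      using finite_vec_decompositions by (subst sum.Sigma) (auto simp: split_def)
    also have "\<dots> = (\<Sum>(i, c) | i + c = k. f i * (\<Sum>(j, l) | j + l = c. g j * h l))"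
      by (simp add: split_def sum_distrib_left)
    finally show "(\<Sum>(u, c) | u + c = k. (\<Sum>(i, j) | i + j = u. f i * g j) * h c) =
                  (\<Sum>(i, c) | i + c = k. f i * (\<Sum>(j, l) | j + l = c. g j * h l))" .
  qed
qed

end

lemma exists_extremal_pair:
  fixes S T :: "(nat ^ 'n) set"
  assumes "finite U" "S \<noteq> {}" "T \<noteq> {}"
  shows "\<exists>i\<in>S. \<exists>j\<in>T. \<forall>u\<in>S. \<forall>v\<in>T.
           (\<forall>x\<in>U. u $ x + v $ x = i $ x + j $ x) \<longrightarrow> (\<forall>x\<in>U. u $ x = i $ x \<and> v $ x = j $ x)"
  using assms
proof (induction U arbitrary: S T rule: finite_induct)
  case empty
  then show ?case by auto
next
  case (insert a U)
  define m where "m = (\<lambda>S :: (nat ^ 'n) set. LEAST c. \<exists>u\<in>S. u $ a = c)"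
  have m_le: "m S \<le> u $ a" if "u \<in> S" for S u
    unfolding m_def by (rule Least_le) (use that in auto)
  have m_ex: "\<exists>u\<in>S. u $ a = m S" if "S \<noteq> {}" for S
    unfolding m_def by (rule LeastI_ex) (use that in auto)
  have "{u\<in>S. u $ a = m S} \<noteq> {}" "{u\<in>T. u $ a = m T} \<noteq> {}"
    using m_ex insert.prems by auto
  from insert.IH[OF this] obtain i j where ij: "i \<in> S" "i $ a = m S" "j \<in> T" "j $ a = m T"
    and min: "\<And>u v. u \<in> S \<Longrightarrow> u $ a = m S \<Longrightarrow> v \<in> T \<Longrightarrow> v $ a = m T \<Longrightarrow>
      \<forall>x\<in>U. u $ x + v $ x = i $ x + j $ x \<Longrightarrow> \<forall>x\<in>U. u $ x = i $ x \<and> v $ x = j $ x"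
    by blast
  have "\<forall>x\<in>insert a U. u $ x = i $ x \<and> v $ x = j $ x"
    if "u \<in> S" "v \<in> T" and eq: "\<forall>x\<in>insert a U. u $ x + v $ x = i $ x + j $ x" for u v
  proof -
    have "u $ a = m S" "v $ a = m T"
      using m_le[OF that(1)] m_le[OF that(2)] eq ij by auto
    with min[OF that(1) _ that(2)] eq ij show ?thesis by auto
  qed
  with ij show ?case by blast
qed

instance mfps :: (idom, finite) idom
proof
  fix f g :: "('a, 'b) mfps"
  assume "f \<noteq> 0" "g \<noteq> 0"
  then have "{i. mfps_nth f i \<noteq> 0} \<noteq> {}" "{j. mfps_nth g j \<noteq> 0} \<noteq> {}"
    by (auto intro!: mfps_eqI simp: zero_mfps.rep_eq)
  from exists_extremal_pair[OF finite_class.finite_UNIV this]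
  obtain i j where ij: "mfps_nth f i \<noteq> 0" "mfps_nth g j \<noteq> 0"
    and extremal: "\<And>u v. mfps_nth f u \<noteq> 0 \<Longrightarrow> mfps_nth g v \<noteq> 0 \<Longrightarrow>
      \<forall>x. u $ x + v $ x = i $ x + j $ x \<Longrightarrow> \<forall>x. u $ x = i $ x \<and> v $ x = j $ x"
    by simp blast
  have uniq: "u = i \<and> v = j" if "mfps_nth f u \<noteq> 0" "mfps_nth g v \<noteq> 0" "u + v = i + j" for u v
  proof -
    have "\<forall>x. u $ x + v $ x = i $ x + j $ x"
      using that(3) by (metis vector_add_component)
    from extremal[OF that(1,2) this] show ?thesis
      by (simp add: vec_eq_iff)
  qed
  have "mfps_nth (f * g) (i + j) = (\<Sum>(u, v) | u + v = i + j. mfps_nth f u * mfps_nth g v)"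
    by (simp add: times_mfps.rep_eq)
  also have "\<dots> = (\<Sum>(u, v) \<in> {(i, j)}. mfps_nth f u * mfps_nth g v)"
  proof (rule sum.mono_neutral_right)
    show "\<forall>x\<in>{(u, v). u + v = i + j} - {(i, j)}. (case x of (u, v) \<Rightarrow> mfps_nth f u * mfps_nth g v) = 0"
      using uniq by fastforce
  qed (auto simp: finite_vec_decompositions)
  also have "\<dots> \<noteq> 0"
    using ij by simp
  finally show "f * g \<noteq> 0"
    by (auto simp: zero_mfps.rep_eq)
qed


section \<open>Polynomials, rational functions, degree and heights\<close>

text \<open>
  The polynomial ring in the variables \<open>t\<close> is the type \<open>nat ^ 'n \<Rightarrow>\<^sub>0 'a\<close> of finitely supported
  coefficient families.
\<close>

definition mfps_of_mpoly :: "(nat ^ 'n \<Rightarrow>\<^sub>0 'a::zero) \<Rightarrow> ('a, 'n) mfps" where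
  "mfps_of_mpoly p = Abs_mfps (Poly_Mapping.lookup p)"

definition mfps_field :: "('a::field, 'n::finite) mfps fract ring" where
  "mfps_field = ring_of_type_algebra"

text \<open>The field of rational functions, as a subfield of the field of fractions of the power
  series ring.\<close>

definition ratfuns :: "('a::field, 'n::finite) mfps fract set" where
  "ratfuns = {Fract (mfps_of_mpoly p) (mfps_of_mpoly r) | p r. r \<noteq> 0}"

definition mfps_algebraic :: "('a::field, 'n::finite) mfps \<Rightarrow> bool" where
  "mfps_algebraic f \<longleftrightarrow> ring.algebraic mfps_field ratfuns (Fract f 1)"

definition mfps_degree :: "('a::field, 'n::finite) mfps \<Rightarrow> nat" where
  "mfps_degree f =
     ring.dim mfps_field ratfuns (generate_field mfps_field (insert (Fract f 1) ratfuns))"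

text \<open>
  A polynomial \<open>A(t, y)\<close> is represented as a polynomial in \<open>y\<close> with coefficients in the
  polynomial ring in \<open>t\<close>.
\<close>

definition annihilates ::
    "(nat ^ 'n \<Rightarrow>\<^sub>0 'a) poly \<Rightarrow> ('a::field, 'n::finite) mfps \<Rightarrow> bool" where
  "annihilates A f \<longleftrightarrow> poly (map_poly mfps_of_mpoly A) f = 0"

text \<open>The exponents of \<open>t\<close> occurring in \<open>A(t, y)\<close>; nonempty if \<open>A \<noteq> 0\<close>.\<close>

definition t_exponents :: "(nat ^ 'n \<Rightarrow>\<^sub>0 'a::zero) poly \<Rightarrow> (nat ^ 'n) set" where
  "t_exponents A = (\<Union>j\<le>Polynomial.degree A. Poly_Mapping.keys (Polynomial.coeff A j))"

definition t_degree :: "'n \<Rightarrow> (nat ^ 'n \<Rightarrow>\<^sub>0 'a::zero) poly \<Rightarrow> nat" where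
  "t_degree k A = Max ((\<lambda>i. i $ k) ` t_exponents A)"

definition t_total_degree :: "(nat ^ 'n::finite \<Rightarrow>\<^sub>0 'a::zero) poly \<Rightarrow> nat" where
  "t_total_degree A = Max ((\<lambda>i. \<Sum>k\<in>UNIV. i $ k) ` t_exponents A)"

definition partial_height :: "'n \<Rightarrow> ('a::field, 'n::finite) mfps \<Rightarrow> nat" where
  "partial_height k f = (LEAST m. \<exists>A. A \<noteq> 0 \<and> annihilates A f \<and> t_degree k A = m)"

definition total_height :: "('a::field, 'n::finite) mfps \<Rightarrow> nat" where
  "total_height f = (LEAST m. \<exists>A. A \<noteq> 0 \<and> annihilates A f \<and> t_total_degree A = m)"


section \<open>Automata and state complexity\<close>

text \<open>
  Up to renaming of states, every finite automaton has its states in \<open>nat\<close>. The transition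
  function is relevant only on \<open>states\<close> and on the input alphabet, the output
  function only on \<open>states\<close>.
\<close>

record ('l, 'o) dfao =
  states :: "nat set"
  init :: nat
  next_state :: "nat \<Rightarrow> 'l \<Rightarrow> nat"
  out :: "nat \<Rightarrow> 'o"

definition is_dfao :: "'l set \<Rightarrow> ('l, 'o) dfao \<Rightarrow> bool" where
  "is_dfao \<Sigma> M \<longleftrightarrow> finite (states M) \<and> init M \<in> states M \<and>
     (\<forall>s\<in>states M. \<forall>l\<in>\<Sigma>. next_state M s l \<in> states M)"

definition dfao_output :: "('l, 'o) dfao \<Rightarrow> 'l list \<Rightarrow> 'o" where
  "dfao_output M w = out M (foldl (next_state M) (init M) w)"

definition digit_vectors :: "nat \<Rightarrow> (nat ^ 'n) set" where
  "digit_vectors q = {l. \<forall>k. l $ k < q}"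

text \<open>
  The base-\<open>q\<close> expansions of the components of \<open>i\<close>, padded to length \<open>L\<close>, with the least
  significant digits at the head of the list. It represents \<open>i\<close> iff \<open>\<forall>k. i $ k < q ^ L\<close>;
  the empty word is thus one of the expansions of \<open>0\<close>.
\<close>

definition lsd_expansion :: "nat \<Rightarrow> nat \<Rightarrow> nat ^ 'n \<Rightarrow> (nat ^ 'n) list" where
  "lsd_expansion q L i = map (\<lambda>j. \<chi> k. (i $ k div q ^ j) mod q) [0..<L]"

definition generates_reverse ::
    "nat \<Rightarrow> (nat ^ 'n, 'o) dfao \<Rightarrow> (nat ^ 'n \<Rightarrow> 'o) \<Rightarrow> bool" where
  "generates_reverse q M a \<longleftrightarrow>
     (\<forall>i L. (\<forall>k. i $ k < q ^ L) \<longrightarrow> dfao_output M (lsd_expansion q L i) = a i)"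

definition generates_direct ::
    "nat \<Rightarrow> (nat ^ 'n, 'o) dfao \<Rightarrow> (nat ^ 'n \<Rightarrow> 'o) \<Rightarrow> bool" where
  "generates_direct q M a \<longleftrightarrow>
     (\<forall>i L. (\<forall>k. i $ k < q ^ L) \<longrightarrow> dfao_output M (rev (lsd_expansion q L i)) = a i)"

text \<open>The complexities are \<open>\<infinity>\<close> if no finite automaton generates the sequence.\<close>

definition comp_reverse :: "nat \<Rightarrow> (nat ^ 'n \<Rightarrow> 'o) \<Rightarrow> enat" where
  "comp_reverse q a =
     (INF M \<in> {M. is_dfao (digit_vectors q) M \<and> generates_reverse q M a}. enat (card (states M)))"

definition comp_direct :: "nat \<Rightarrow> (nat ^ 'n \<Rightarrow> 'o) \<Rightarrow> enat" where
  "comp_direct q a =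
     (INF M \<in> {M. is_dfao (digit_vectors q) M \<and> generates_direct q M a}. enat (card (states M)))"

end

(*
  Let E(t, y) be an annihilating polynomial of f of minimal degree in y and, among these, of minimal
  total degree in t. By Gauss's lemma E divides every annihilating polynomial, so it realizes the
  degree, the total height and all the partial heights at once. Separability of E in y, i.e.
  E_y(t, f) \<noteq> 0, follows by extracting p-th roots with section operators.

  The elements P(t, f) / E_y(t, f) of the power series ring are the residues of P / E at y = f. As
  P / E = P E^(q-1) / E^q, the section operators map P(t, f) / E_y(t, f) to P'(t, f) / E_y(t, f) with
  P' a section of P E^(q-1), whose exponents again lie in the region spanned by those of E. Moreover
  f = f E_y(t, f) / E_y(t, f) is of this form, with P = y E_y of degree d in y, and after one section
  the degree drops below d. Hence f together with at most q^N residues is closed under sections, which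
  gives the automaton in reverse reading. In direct reading, the states are linear functionals on
  the space of all residues with P of degree at most d, which has at most q^N' elements.
*)
theory Submission
  imports Defs "HOL-Algebra.Sylow"
begin

section \<open>Unique factorization for subrings of a domain\<close>

text \<open>The heights are minima taken separately, while the count needs the exponents of a single
  \<open>E\<close> to lie both in the box given by the \<open>h_i\<close> and in the simplex given
  by \<open>h\<close>. This is why divisibility by \<open>E\<close>, and with it unique
  factorization in \<open>F_q[t][y]\<close>, has to be established. Polynomials in \<open>t\<close>
  are treated as power series of finite support. Then \<open>f\<close> can be substituted directly,
  but factorization must be formulated relative to a subring of the ambient domain. Sections act on
  \<open>y\<close> through the exponents \<open>q j + q - 1\<close>, as the Cartier operator does on
  differentials; this choice preserves the residue at \<open>y = f\<close>. It also causes the drop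
  in degree: \<open>P E^(q-1)\<close> has degree at most \<open>q d\<close>, which is less than
  \<open>q d + q - 1\<close>. The exponents \<open>N\<close> and \<open>N'\<close> count
  coefficients. A \<open>P\<close> of degree below \<open>d\<close> has \<open>d\<close>
  coefficients in \<open>y\<close>, each supported in the intersection of box and simplex.\<close>

locale subdomain =
  fixes S :: "'a::idom set"
  assumes one_closed [simp, intro]: "1 \<in> S"
    and diff_closed [simp, intro]: "a \<in> S \<Longrightarrow> b \<in> S \<Longrightarrow> a - b \<in> S"
    and mult_closed [simp, intro]: "a \<in> S \<Longrightarrow> b \<in> S \<Longrightarrow> a * b \<in> S"
begin

lemma zero_closed [simp, intro]: "0 \<in> S"
  using diff_closed[OF one_closed one_closed] by simp

lemma uminus_closed [simp, intro]: "a \<in> S \<Longrightarrow> - a \<in> S"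
  using diff_closed[OF zero_closed, of a] by simp

lemma add_closed [simp, intro]: "a \<in> S \<Longrightarrow> b \<in> S \<Longrightarrow> a + b \<in> S"
  using diff_closed[of a "- b"] by simp

lemma sum_closed: "(\<And>x. x \<in> A \<Longrightarrow> g x \<in> S) \<Longrightarrow> sum g A \<in> S"
  by (induction A rule: infinite_finite_induct) auto

lemma power_closed: "a \<in> S \<Longrightarrow> a ^ k \<in> S"
  by (induction k) auto

end

text \<open>The cofactor has to lie in \<open>S\<close>. In the ambient ring of power series over a
  field, \<open>dvd\<close> would say too little: every polynomial with nonzero constant coefficient
  is a unit there.\<close>

definition dvd_in :: "'a::idom set \<Rightarrow> 'a \<Rightarrow> 'a \<Rightarrow> bool" where
  "dvd_in S a b \<longleftrightarrow> (\<exists>c\<in>S. b = a * c)"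

definition prime_in :: "'a::idom set \<Rightarrow> 'a \<Rightarrow> bool" where
  "prime_in S p \<longleftrightarrow> p \<in> S \<and> p \<noteq> 0 \<and> \<not> dvd_in S p 1 \<and>
     (\<forall>a\<in>S. \<forall>b\<in>S. dvd_in S p (a * b) \<longrightarrow> dvd_in S p a \<or> dvd_in S p b)"

text \<open>The index counts the primes and leaves out the unit. It is the quantity that descends
  when \<open>factorial_in_polys_over\<close> extracts constants.\<close>

inductive prime_product :: "'a::idom set \<Rightarrow> nat \<Rightarrow> 'a \<Rightarrow> bool" for S where
  unit: "u \<in> S \<Longrightarrow> dvd_in S u 1 \<Longrightarrow> prime_product S 0 u"
| step: "prime_in S p \<Longrightarrow> prime_product S k a \<Longrightarrow> prime_product S (Suc k) (p * a)"

text \<open>The factors are prime and not merely irreducible, so the existence of such a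
  factorization already entails its uniqueness.\<close>

definition factorial_in :: "'a::idom set \<Rightarrow> bool" where
  "factorial_in S \<longleftrightarrow> (\<forall>a\<in>S. a \<noteq> 0 \<longrightarrow> (\<exists>k. prime_product S k a))"

definition polys_over :: "'a::idom set \<Rightarrow> 'a poly set" where
  "polys_over S = {p. \<forall>i. coeff p i \<in> S}"

lemma (in subdomain) const_polys_over [simp, intro]: "c \<in> S \<Longrightarrow> [:c:] \<in> polys_over S"
  by (auto simp: polys_over_def coeff_pCons split: nat.splits)

lemma polys_over_coeff: "p \<in> polys_over S \<Longrightarrow> coeff p i \<in> S"
  by (simp add: polys_over_def)

lemma (in subdomain) monom_polys_over: "c \<in> S \<Longrightarrow> monom c k \<in> polys_over S"
  by (auto simp: polys_over_def)

lemma (in subdomain) subdomain_polys_over: "subdomain (polys_over S)"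
proof
  show "1 \<in> polys_over S"
    by (auto simp: polys_over_def coeff_1)
  fix a b assume "a \<in> polys_over S" "b \<in> polys_over S"
  then show "a - b \<in> polys_over S" "a * b \<in> polys_over S"
    by (auto simp: polys_over_def coeff_mult intro!: sum_closed)
qed

lemma dvd_inI: "c \<in> S \<Longrightarrow> b = a * c \<Longrightarrow> dvd_in S a b"
  by (auto simp: dvd_in_def)

context subdomain
begin

lemma dvd_in_add: "dvd_in S a b \<Longrightarrow> dvd_in S a c \<Longrightarrow> dvd_in S a (b + c)"
  unfolding dvd_in_def by (metis add_closed distrib_left)

lemma dvd_in_diff: "dvd_in S a b \<Longrightarrow> dvd_in S a c \<Longrightarrow> dvd_in S a (b - c)"
  unfolding dvd_in_def by (metis diff_closed right_diff_distrib)

lemma dvd_in_zero: "dvd_in S a 0"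
  unfolding dvd_in_def by (metis mult_zero_right zero_closed)

lemma dvd_in_sum: "(\<And>x. x \<in> A \<Longrightarrow> dvd_in S a (g x)) \<Longrightarrow> dvd_in S a (sum g A)"
  by (induction A rule: infinite_finite_induct) (auto intro: dvd_in_add dvd_in_zero)

lemma dvd_in_mult: "dvd_in S a b \<Longrightarrow> c \<in> S \<Longrightarrow> dvd_in S a (b * c)"
  unfolding dvd_in_def by (metis mult_closed mult.assoc)

lemma dvd_in_trans: "dvd_in S a b \<Longrightarrow> dvd_in S b c \<Longrightarrow> dvd_in S a c"
  unfolding dvd_in_def by (metis mult_closed mult.assoc)

lemma unit_mult:
  assumes "dvd_in S u 1" "dvd_in S v 1"
  shows "dvd_in S (u * v) 1"
proof -
  obtain x y where "x \<in> S" "y \<in> S" "1 = u * x" "1 = v * y"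
    using assms by (auto simp: dvd_in_def)
  then have "1 = (u * v) * (x * y)" "x * y \<in> S"
    by (metis mult.left_commute mult.assoc mult_1_right, auto)
  then show ?thesis by (rule dvd_inI[rotated])
qed

lemma prime_product_closed: "prime_product S k a \<Longrightarrow> a \<in> S"
  by (induction rule: prime_product.induct) (auto simp: prime_in_def)

lemma prime_product_unit_mult:
  "prime_product S k a \<Longrightarrow> u \<in> S \<Longrightarrow> dvd_in S u 1 \<Longrightarrow> prime_product S k (u * a)"
proof (induction rule: prime_product.induct)
  case (unit v)
  then show ?case by (auto intro: prime_product.unit unit_mult)
next
  case (step p k a)
  then show ?case
    using prime_product.step[OF step.hyps(1), of k "u * a"] by (simp add: mult_ac)
qed

lemma prime_product_mult:
  "prime_product S k a \<Longrightarrow> prime_product S l b \<Longrightarrow> prime_product S (k + l) (a * b)"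
  by (induction rule: prime_product.induct)
     (auto simp: prime_product_unit_mult mult.assoc intro: prime_product.step)

lemma prime_product_prime: "prime_in S p \<Longrightarrow> prime_product S 1 p"
  using prime_product.step[OF _ prime_product.unit[of 1 S]] by (auto simp: dvd_in_def)

text \<open>The first factor \<open>r\<close> divides \<open>p * b\<close>. If it divides
  \<open>b\<close>, it is cancelled and induction applies; if it divides \<open>p\<close>, then
  \<open>p\<close> and \<open>r\<close> differ by a unit, which is absorbed into the remaining
  factors. So the count drops by exactly one.\<close>

lemma prime_product_cancel:
  assumes "prime_product S k x" "prime_in S p" "b \<in> S" "x = p * b"
  shows "k > 0 \<and> prime_product S (k - 1) b"
  using assms
proof (induction arbitrary: b rule: prime_product.induct)
  case (unit u)
  then have "dvd_in S p 1"
    by (metis dvd_in_def dvd_in_trans)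
  then show ?case using unit by (simp add: prime_in_def)
next
  case (step r k y)
  have r: "r \<in> S" "r \<noteq> 0" and p: "p \<in> S" "p \<noteq> 0"
    using step by (auto simp: prime_in_def)
  have y: "y \<in> S"
    using step.hyps(2) by (rule prime_product_closed)
  have "dvd_in S r (p * b)"
    using step y by (metis dvd_in_def)
  then consider "dvd_in S r b" | "dvd_in S r p"
    using step.hyps(1) step.prems(2) p unfolding prime_in_def by blast
  then show ?case
  proof cases
    case 1
    then obtain b' where b': "b' \<in> S" "b = r * b'" by (auto simp: dvd_in_def)
    have "r * y = r * (p * b')"
      using step.prems(3) b' by (simp add: mult_ac)
    then have "y = p * b'"
      using r by simp
    from step.IH[OF step.prems(1) b'(1) this]
    have "k > 0" "prime_product S (k - 1) b'" by auto
    with prime_product.step[OF step.hyps(1) this(2)] b' show ?thesis by simp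
  next
    case 2
    then obtain u where u: "u \<in> S" "p = r * u" by (auto simp: dvd_in_def)
    have "dvd_in S p (r * u)"
      unfolding u(2)[symmetric] by (rule dvd_inI[of 1]) auto
    then consider "dvd_in S p r" | "dvd_in S p u"
      using step.prems(1) r u unfolding prime_in_def by blast
    then have "dvd_in S u 1"
    proof cases
      case 1
      then obtain w where "w \<in> S" "r = p * w" by (auto simp: dvd_in_def)
      then have "r * 1 = r * (u * w)" using u by (simp add: mult_ac)
      then have "1 = u * w" using r by simp
      then show ?thesis using \<open>w \<in> S\<close> by (rule dvd_inI[rotated])
    next
      case 2
      then obtain w where "w \<in> S" "u = p * w" by (auto simp: dvd_in_def)
      then have "p * 1 = p * (r * w)" using u by (simp add: mult_ac)
      then have "1 = r * w" using p by simp
      then have "dvd_in S r 1" using \<open>w \<in> S\<close> by (rule dvd_inI[rotated])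
      then show ?thesis using step.hyps(1) by (simp add: prime_in_def)
    qed
    then obtain v where v: "v \<in> S" "1 = u * v" by (auto simp: dvd_in_def)
    have "r * y = r * (u * b)"
      using step.prems(3) u by (simp add: mult_ac)
    then have "y = u * b"
      using r by simp
    then have "b = v * y"
      using v by (metis mult.left_commute mult.assoc mult_1_right)
    moreover have "dvd_in S v 1"
      using v u by (auto simp: dvd_in_def mult.commute)
    ultimately show ?thesis
      using prime_product_unit_mult[OF step.hyps(2) v(1)] by simp
  qed
qed

text \<open>Each prime of \<open>c\<close> divides \<open>e\<close> or \<open>b\<close>, is moved
  there and cancelled. This does the work of gcds and contents in all that follows.\<close>

lemma prime_product_split:
  assumes "prime_product S k c" "a \<in> S" "e \<in> S" "b \<in> S" "c * a = e * b"
  shows "\<exists>c1\<in>S. \<exists>c2\<in>S. \<exists>e'\<in>S. \<exists>b'\<in>S. c = c1 * c2 \<and> e = c1 * e' \<and> b = c2 * b' \<and> a = e' * b'"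
  using assms
proof (induction arbitrary: e b rule: prime_product.induct)
  case (unit u)
  then obtain v where v: "v \<in> S" "1 = u * v" by (auto simp: dvd_in_def)
  have "e = u * (v * e)" "a = v * e * b"
    using v unit.prems(4) by (metis mult.assoc mult_1_left, metis mult.assoc mult.commute mult_1_left)
  then show ?case
    using v unit by (intro bexI[of _ u] bexI[of _ 1] bexI[of _ "v * e"] bexI[of _ b]) auto
next
  case (step p k c)
  have p: "p \<in> S" "p \<noteq> 0" using step by (auto simp: prime_in_def)
  have c: "c \<in> S" using step.hyps(2) by (rule prime_product_closed)
  have "dvd_in S p (e * b)"
    using step.prems c by (metis dvd_inI mult.assoc mult_closed)
  then consider "dvd_in S p e" | "dvd_in S p b"
    using step.hyps(1) step.prems(2,3) unfolding prime_in_def by blast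
  then show ?case
  proof cases
    case 1
    then obtain e1 where e1: "e1 \<in> S" "e = p * e1" by (auto simp: dvd_in_def)
    have "p * (c * a) = p * (e1 * b)" using step.prems e1 by (simp add: mult_ac)
    then have "c * a = e1 * b" using p by simp
    from step.IH[OF step.prems(1) e1(1) step.prems(3) this]
    obtain c1 c2 e' b' where *: "c1\<in>S" "c2\<in>S" "e'\<in>S" "b'\<in>S"
      "c = c1 * c2" "e1 = c1 * e'" "b = c2 * b'" "a = e' * b'" by blast
    show ?thesis
      by (rule bexI[of _ "p * c1"], rule bexI[of _ c2], rule bexI[of _ e'], rule bexI[of _ b'])
        (use * p e1 in \<open>auto simp: mult_ac\<close>)
  next
    case 2
    then obtain b1 where b1: "b1 \<in> S" "b = p * b1" by (auto simp: dvd_in_def)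
    have "p * (c * a) = p * (e * b1)" using step.prems b1 by (simp add: mult_ac)
    then have "c * a = e * b1" using p by simp
    from step.IH[OF step.prems(1,2) b1(1) this]
    obtain c1 c2 e' b' where *: "c1\<in>S" "c2\<in>S" "e'\<in>S" "b'\<in>S"
      "c = c1 * c2" "e = c1 * e'" "b1 = c2 * b'" "a = e' * b'" by blast
    show ?thesis
      by (rule bexI[of _ c1], rule bexI[of _ "p * c2"], rule bexI[of _ e'], rule bexI[of _ b'])
        (use * p b1 in \<open>auto simp: mult_ac\<close>)
  qed
qed

section \<open>Polynomials over a factorial subring\<close>

lemma dvd_in_const_iff:
  "dvd_in (polys_over S) [:p:] g \<longleftrightarrow> (\<forall>i. dvd_in S p (coeff g i))" if "p \<in> S"
proof
  assume "dvd_in (polys_over S) [:p:] g"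
  then show "\<forall>i. dvd_in S p (coeff g i)"
    by (auto simp: dvd_in_def polys_over_def)
next
  assume *: "\<forall>i. dvd_in S p (coeff g i)"
  \<comment> \<open>Zero coefficients must get the quotient 0, so that \<open>h\<close> has finite
    support and \<open>Abs_poly\<close> is meaningful.\<close>
  define h where "h = (\<lambda>i. if coeff g i = 0 then 0 else SOME c. c \<in> S \<and> coeff g i = p * c)"
  have h: "h i \<in> S \<and> coeff g i = p * h i" for i
  proof (cases "coeff g i = 0")
    case False
    then show ?thesis
      using * someI_ex[of "\<lambda>c. c \<in> S \<and> coeff g i = p * c"] by (auto simp: h_def dvd_in_def)
  qed (auto simp: h_def)
  have "coeff (Abs_poly h) i = h i" for i
    by (subst Abs_poly_inverse)
      (auto intro!: MOST_mono[OF MOST_coeff_eq_0[of g]] simp: h_def)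
  then show "dvd_in (polys_over S) [:p:] g"
    using h by (intro dvd_inI[of "Abs_poly h"]) (auto simp: polys_over_def poly_eq_iff)
qed

text \<open>Gauss's argument: take the least \<open>i\<close> and \<open>j\<close> such that
  \<open>p\<close> divides neither \<open>coeff a i\<close> nor \<open>coeff b j\<close>. In the
  coefficient of the product at \<open>i + j\<close>, every other term is divisible by
  \<open>p\<close>.\<close>

lemma prime_in_const:
  assumes "prime_in S p"
  shows "prime_in (polys_over S) [:p:]"
proof -
  have p: "p \<in> S" "p \<noteq> 0" using assms by (auto simp: prime_in_def)
  have "\<not> dvd_in (polys_over S) [:p:] 1"
    using assms by (auto simp: dvd_in_const_iff p prime_in_def intro!: exI[of _ 0])
  moreover have "dvd_in (polys_over S) [:p:] a \<or> dvd_in (polys_over S) [:p:] b"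
    if ab: "a \<in> polys_over S" "b \<in> polys_over S" and dvd: "dvd_in (polys_over S) [:p:] (a * b)" for a b
  proof (rule ccontr)
    assume "\<not> ?thesis"
    then have ex: "\<exists>i. \<not> dvd_in S p (coeff a i)" "\<exists>i. \<not> dvd_in S p (coeff b i)"
      by (auto simp: dvd_in_const_iff p)
    define i where "i = (LEAST i. \<not> dvd_in S p (coeff a i))"
    define j where "j = (LEAST i. \<not> dvd_in S p (coeff b i))"
    have i: "\<not> dvd_in S p (coeff a i)" "\<And>k. k < i \<Longrightarrow> dvd_in S p (coeff a k)"
      unfolding i_def by (rule LeastI_ex[OF ex(1)], use not_less_Least in blast)
    have j: "\<not> dvd_in S p (coeff b j)" "\<And>k. k < j \<Longrightarrow> dvd_in S p (coeff b k)"
      unfolding j_def by (rule LeastI_ex[OF ex(2)], use not_less_Least in blast)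
    have dvd_ij: "dvd_in S p (coeff (a * b) (i + j))"
      using dvd by (simp add: dvd_in_const_iff p)
    have split: "coeff (a * b) (i + j) =
      coeff a i * coeff b j + (\<Sum>k\<in>{..i+j} - {i}. coeff a k * coeff b (i + j - k))"
      unfolding coeff_mult by (subst sum.remove[of _ i]) auto
    have "dvd_in S p (\<Sum>k\<in>{..i+j} - {i}. coeff a k * coeff b (i + j - k))"
    proof (rule dvd_in_sum)
      fix k assume k: "k \<in> {..i + j} - {i}"
      show "dvd_in S p (coeff a k * coeff b (i + j - k))"
      proof (cases "k < i")
        case True
        then show ?thesis using i(2) ab by (intro dvd_in_mult polys_over_coeff) auto
      next
        case False
        then have "i + j - k < j" using k by auto
        then have "dvd_in S p (coeff b (i + j - k) * coeff a k)"
          using j(2) ab by (intro dvd_in_mult polys_over_coeff) auto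
        then show ?thesis by (simp add: mult.commute)
      qed
    qed
    from dvd_in_diff[OF dvd_ij this] have "dvd_in S p (coeff a i * coeff b j)"
      unfolding split by simp
    then show False
      using assms i(1) j(1) polys_over_coeff[OF ab(1)] polys_over_coeff[OF ab(2)]
      by (auto simp: prime_in_def)
  qed
  ultimately show ?thesis
    using p by (auto simp: prime_in_def)
qed

lemma prime_product_const: "prime_product S k c \<Longrightarrow> prime_product (polys_over S) k [:c:]"
proof (induction rule: prime_product.induct)
  case (unit u)
  then obtain v where "v \<in> S" "1 = u * v" by (auto simp: dvd_in_def)
  then show ?case
    using unit by (intro prime_product.unit dvd_inI[of "[:v:]"]) (auto simp: one_pCons mult.commute)
next
  case (step p k a)
  then show ?case
    using prime_product.step[OF prime_in_const[OF step.hyps(1)] step.IH] by (simp add: mult.commute)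
qed

text \<open>Each step multiplies \<open>g\<close> by the leading coefficient of \<open>f\<close>
  instead of dividing by it; \<open>c\<close> is the accumulated power of that coefficient.\<close>

lemma pseudo_division:
  assumes "f \<in> polys_over S" "f \<noteq> 0" "g \<in> polys_over S"
  shows "\<exists>c\<in>S. \<exists>s\<in>polys_over S. \<exists>r\<in>polys_over S.
           c \<noteq> 0 \<and> [:c:] * g = f * s + r \<and> (r = 0 \<or> degree r < degree f)"
  using assms(3)
proof (induction "degree g" arbitrary: g rule: less_induct)
  case less
  interpret P: subdomain "polys_over S" by (rule subdomain_polys_over)
  show ?case
  proof (cases "g = 0 \<or> degree g < degree f")
    case True
    then show ?thesis
      using less.prems
      by (intro bexI[of _ 1] bexI[of _ 0] bexI[of _ g]) (auto simp: one_pCons[symmetric])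
  next
    case False
    define m where "m = monom (lead_coeff g) (degree g - degree f)"
    have m: "m \<in> polys_over S"
      unfolding m_def using less.prems by (intro monom_polys_over polys_over_coeff)
    define l where "l = lead_coeff f"
    have l: "l \<in> S" "l \<noteq> 0"
      using assms by (auto simp: l_def intro: polys_over_coeff)
    define g' where "g' = [:l:] * g - f * m"
    have g': "g' \<in> polys_over S"
      unfolding g'_def using less.prems assms l m
      by (intro P.diff_closed P.mult_closed const_polys_over)
    have "lead_coeff g \<noteq> 0" using False by auto
    then have deg_fm: "degree (f * m) = degree g"
      using False assms by (subst degree_mult_eq) (auto simp: m_def degree_monom_eq monom_eq_0_iff)
    have lc: "coeff (f * m) (degree g) = l * lead_coeff g"
      using lead_coeff_mult[of f m] unfolding deg_fm l_def
      by (simp add: m_def degree_monom_eq[OF \<open>lead_coeff g \<noteq> 0\<close>])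
    have "degree g' \<le> degree g"
      unfolding g'_def using deg_fm l by (intro degree_diff_le) auto
    moreover have "coeff g' (degree g) = 0"
      using lc by (simp add: g'_def)
    ultimately have small: "g' = 0 \<or> degree g' < degree g"
      by (metis le_neq_implies_less leading_coeff_0_iff)
    have "\<exists>c\<in>S. \<exists>s\<in>polys_over S. \<exists>r\<in>polys_over S.
            c \<noteq> 0 \<and> [:c:] * g' = f * s + r \<and> (r = 0 \<or> degree r < degree f)"
    proof (cases "g' = 0")
      case True
      then show ?thesis by (intro bexI[of _ 1] bexI[of _ 0]) auto
    next
      case False
      then show ?thesis using less.hyps small g' by blast
    qed
    then obtain c s r where *: "c \<in> S" "s \<in> polys_over S" "r \<in> polys_over S" "c \<noteq> 0"
      "[:c:] * g' = f * s + r" "r = 0 \<or> degree r < degree f" by blast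
    have "[:c * l:] * g = [:c:] * ([:l:] * g)" by (simp add: mult.commute)
    also have "[:l:] * g = g' + f * m" by (simp add: g'_def)
    also have "[:c:] * (g' + f * m) = f * (s + [:c:] * m) + r"
      using * by (simp add: algebra_simps)
    finally have "[:c * l:] * g = f * (s + [:c:] * m) + r" .
    moreover have "s + [:c:] * m \<in> polys_over S"
      using * l m by (intro P.add_closed P.mult_closed const_polys_over)
    moreover have "c * l \<in> S" "c * l \<noteq> 0"
      using * l by auto
    ultimately show ?thesis
      using *(3,6) by blast
  qed
qed

text \<open>The argument of Nagata: divide with remainder over the field of fractions of \<open>S\<close>, clear the
  denominators, and cancel their prime factors, none of which divides \<open>f\<close>.\<close>

lemma prime_in_polys_over:
  assumes fact: "factorial_in S"
    and f: "f \<in> polys_over S" "degree f > 0"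
    and prim: "\<And>p. prime_in S p \<Longrightarrow> \<not> dvd_in (polys_over S) [:p:] f"
    and irred: "\<And>g h. g \<in> polys_over S \<Longrightarrow> h \<in> polys_over S \<Longrightarrow> f = g * h \<Longrightarrow>
                  degree g = 0 \<or> degree h = 0"
  shows "prime_in (polys_over S) f"
proof -
  interpret P: subdomain "polys_over S" by (rule subdomain_polys_over)
  have f0: "f \<noteq> 0" using f by auto
  \<comment> \<open>\<open>f\<close> is primitive: a prime factor of a constant divisor of
    \<open>f\<close> would be a prime constant dividing \<open>f\<close>.\<close>
  have const_unit: "dvd_in (polys_over S) g 1"
    if g: "g \<in> polys_over S" "degree g = 0" "dvd_in (polys_over S) g f" for g
  proof -
    obtain c where c: "g = [:c:]" using g by (metis degree_eq_zeroE)
    have "c \<in> S" using polys_over_coeff[OF g(1), of 0] c by simp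
    moreover have "c \<noteq> 0" using g c f0 by (auto simp: dvd_in_def)
    ultimately obtain k where "prime_product S k c"
      using fact by (auto simp: factorial_in_def)
    then have prod: "prime_product (polys_over S) k [:c:]"
      by (rule prime_product_const)
    from \<open>prime_product S k c\<close> have "k = 0"
    proof cases
      case (step p k' a)
      then have "dvd_in (polys_over S) [:p:] [:c:]"
        using prime_product_closed by (intro dvd_inI[of "[:a:]"]) auto
      then show ?thesis
        using prim[OF step(3)] g(3) P.dvd_in_trans by (auto simp: c)
    qed simp
    with prod show ?thesis
      unfolding c by (auto elim: prime_product.cases)
  qed
  \<comment> \<open>The primes of \<open>c\<close> are distributed over \<open>f\<close> and
    \<open>y\<close>. The part that falls to \<open>f\<close> is constant, hence a unit, so up to a
    unit all of \<open>c\<close> cancels against \<open>y\<close>.\<close>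
  have cancel: "dvd_in (polys_over S) f x"
    if "c \<in> S" "c \<noteq> 0" "x \<in> polys_over S" "y \<in> polys_over S" "[:c:] * x = f * y" for c x y
  proof -
    have "\<exists>k. prime_product (polys_over S) k [:c:]"
      using fact that(1,2) prime_product_const unfolding factorial_in_def by blast
    then obtain k where "prime_product (polys_over S) k [:c:]" ..
    from P.prime_product_split[OF this that(3) f(1) that(4,5)]
    obtain c1 c2 f' y' where *: "c1 \<in> polys_over S" "c2 \<in> polys_over S" "f' \<in> polys_over S"
      "y' \<in> polys_over S" "[:c:] = c1 * c2" "f = c1 * f'" "x = f' * y'" by blast
    have "degree (c1 * c2) = 0" "c1 * c2 \<noteq> 0"
      unfolding *(5)[symmetric] using that by auto
    then have "degree c1 = 0"
      by (metis add_is_0 degree_mult_eq mult_eq_0_iff)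
    then have "dvd_in (polys_over S) c1 1"
      using const_unit * by (auto simp: dvd_in_def)
    then obtain v where v: "v \<in> polys_over S" "1 = c1 * v" by (auto simp: dvd_in_def)
    have "f * v = f' * (c1 * v)" using * by (simp add: mult_ac)
    then have "f' = f * v" unfolding v(2)[symmetric] by simp
    then have "x = f * (v * y')" unfolding *(7) by (simp only: mult.assoc)
    then show ?thesis using v * by (auto intro!: dvd_inI[of "v * y'"])
  qed
  have "dvd_in (polys_over S) f g \<or> dvd_in (polys_over S) f h"
    if gh: "g \<in> polys_over S" "h \<in> polys_over S" and dvd: "dvd_in (polys_over S) f (g * h)" for g h
  proof -
    \<comment> \<open>A nonzero \<open>r\<close> of least degree in the ideal of \<open>f\<close>
      and \<open>g\<close> divides every member up to a constant factor. If \<open>r\<close> is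
      constant, it is a Bezout combination, and multiplying it by \<open>h\<close> shows that
      \<open>f\<close> divides \<open>h\<close>. Otherwise \<open>r\<close> agrees with
      \<open>f\<close> up to constants, as \<open>f\<close> is irreducible, and so \<open>f\<close>
      divides \<open>g\<close>.\<close>
    define I where "I = {u * f + v * g | u v. u \<in> polys_over S \<and> v \<in> polys_over S}"
    have "1 * f + 0 * g \<in> I" unfolding I_def by blast
    then have "f \<in> I" by simp
    then obtain r where r: "r \<in> I" "r \<noteq> 0"
      and min: "\<And>r'. r' \<in> I \<Longrightarrow> r' \<noteq> 0 \<Longrightarrow> degree r \<le> degree r'"
      using ex_has_least_nat[of "\<lambda>r. r \<in> I \<and> r \<noteq> 0" f degree] f0 by blast
    obtain u v where uv: "u \<in> polys_over S" "v \<in> polys_over S" "r = u * f + v * g"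
      using r(1) by (auto simp: I_def)
    have rP: "r \<in> polys_over S" using uv f gh by auto
    have reduce: "\<exists>c\<in>S. \<exists>s\<in>polys_over S. c \<noteq> 0 \<and> [:c:] * z = r * s"
      if z: "z \<in> I" for z
    proof -
      obtain u' v' where uv': "u' \<in> polys_over S" "v' \<in> polys_over S" "z = u' * f + v' * g"
        using z by (auto simp: I_def)
      have "z \<in> polys_over S" using uv' f gh by auto
      from pseudo_division[OF rP r(2) this] obtain c s r' where
        *: "c \<in> S" "s \<in> polys_over S" "r' \<in> polys_over S" "c \<noteq> 0"
        "[:c:] * z = r * s + r'" "r' = 0 \<or> degree r' < degree r" by blast
      have "r' = [:c:] * z - r * s" using * by simp
      also have "\<dots> = ([:c:] * u' - s * u) * f + ([:c:] * v' - s * v) * g"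
        unfolding uv' uv by (simp only: algebra_simps)
      finally have "r' \<in> I"
        unfolding I_def using * uv uv' by blast
      then have "r' = 0" using min * by fastforce
      then show ?thesis using * by auto
    qed
    show ?thesis
    proof (cases "degree r = 0")
      case True
      then obtain s where s: "r = [:s:]" by (metis degree_eq_zeroE)
      then have "s \<in> S" "s \<noteq> 0"
        using polys_over_coeff[OF rP, of 0] r by auto
      obtain w where w: "w \<in> polys_over S" "g * h = f * w"
        using dvd by (auto simp: dvd_in_def)
      have "[:s:] * h = u * f * h + v * (g * h)"
        unfolding s[symmetric] uv by (simp only: algebra_simps)
      also have "\<dots> = f * (u * h + v * w)"
        unfolding w by (simp only: algebra_simps)
      finally have eq: "[:s:] * h = f * (u * h + v * w)" .
      have "dvd_in (polys_over S) f h"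
        by (rule cancel[OF \<open>s \<in> S\<close> \<open>s \<noteq> 0\<close> gh(2) _ eq])
          (intro P.add_closed P.mult_closed gh uv w)
      then show ?thesis ..
    next
      case False
      obtain c s where c: "c \<in> S" "s \<in> polys_over S" "c \<noteq> 0" "[:c:] * f = r * s"
        using reduce[OF \<open>f \<in> I\<close>] by blast
      obtain k where "prime_product (polys_over S) k [:c:]"
        using fact c(1,3) prime_product_const unfolding factorial_in_def by blast
      from P.prime_product_split[OF this f(1) rP c(2,4)]
      obtain c1 c2 r1 s1 where *: "c1 \<in> polys_over S" "c2 \<in> polys_over S" "r1 \<in> polys_over S"
        "s1 \<in> polys_over S" "[:c:] = c1 * c2" "r = c1 * r1" "f = r1 * s1" by blast
      have "degree (c1 * c2) = 0" "c1 * c2 \<noteq> 0"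
        unfolding *(5)[symmetric] using c by auto
      then have "degree c1 = 0"
        by (metis add_is_0 degree_mult_eq mult_eq_0_iff)
      then have "degree r1 \<noteq> 0"
        using False degree_mult_le[of c1 r1] unfolding *(6) by simp
      then have "degree s1 = 0"
        using irred[OF *(3,4,7)] by auto
      then have "dvd_in (polys_over S) s1 1"
        using const_unit[OF *(4)] * by (auto simp: dvd_in_def mult.commute)
      then obtain t where t: "t \<in> polys_over S" "1 = s1 * t" by (auto simp: dvd_in_def)
      have "f * t = r1 * (s1 * t)" using * by (simp add: mult_ac)
      then have r1: "r1 = f * t" unfolding t(2)[symmetric] by simp
      have "0 * f + 1 * g \<in> I" unfolding I_def by blast
      then obtain c' s' where c': "c' \<in> S" "s' \<in> polys_over S" "c' \<noteq> 0" "[:c':] * g = r * s'"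
        using reduce[of g] by auto
      have eq: "[:c':] * g = f * (t * c1 * s')"
        unfolding c'(4) *(6) r1 by (simp only: mult_ac)
      have "dvd_in (polys_over S) f g"
        by (rule cancel[OF c'(1,3) gh(1) _ eq]) (intro P.mult_closed t * c')
      then show ?thesis ..
    qed
  qed
  moreover have "\<not> dvd_in (polys_over S) f 1"
  proof
    assume "dvd_in (polys_over S) f 1"
    then obtain c where "1 = f * c" by (auto simp: dvd_in_def)
    then have "degree f = 0"
      by (metis add_is_0 degree_1 degree_mult_eq mult_eq_0_iff one_neq_zero)
    then show False using f by simp
  qed
  ultimately show ?thesis
    using f f0 by (auto simp: prime_in_def)
qed

text \<open>Induction on the degree. If \<open>f\<close> does not split into factors of positive
  degree, its content is removed by descent: among all \<open>f = [:c:] * g\<close>, choose one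
  where the leading coefficient of \<open>g\<close> has the fewest primes. A prime constant dividing
  \<open>g\<close> would lower this number, so \<open>prime_in_polys_over\<close> applies to
  \<open>g\<close>.\<close>

lemma factorial_in_polys_over:
  assumes fact: "factorial_in S"
  shows "factorial_in (polys_over S)"
proof -
  interpret P: subdomain "polys_over S" by (rule subdomain_polys_over)
  have "\<exists>k. prime_product (polys_over S) k f" if "f \<in> polys_over S" "f \<noteq> 0" for f
    using that
  proof (induction "degree f" arbitrary: f rule: less_induct)
    case less
    show ?case
    proof (cases "degree f = 0")
      case True
      then obtain c where c: "f = [:c:]" by (metis degree_eq_zeroE)
      then have "c \<in> S" "c \<noteq> 0" using polys_over_coeff[OF less.prems(1), of 0] less.prems by auto
      then show ?thesis
        using fact prime_product_const unfolding c factorial_in_def by blast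
    next
      case deg: False
      show ?thesis
      proof (cases "\<exists>g h. g \<in> polys_over S \<and> h \<in> polys_over S \<and> f = g * h \<and> degree g > 0 \<and> degree h > 0")
        case True
        then obtain g h where gh: "g \<in> polys_over S" "h \<in> polys_over S" "f = g * h"
          "degree g > 0" "degree h > 0" by blast
        then have "degree f = degree g + degree h" "g \<noteq> 0" "h \<noteq> 0"
          using less.prems by (auto simp: degree_mult_eq)
        then obtain k l where "prime_product (polys_over S) k g" "prime_product (polys_over S) l h"
          using less.hyps[of g] less.hyps[of h] gh by auto
        then show ?thesis
          using P.prime_product_mult gh by blast
      next
        case False
        define Q where "Q = (\<lambda>k. \<exists>c\<in>S. \<exists>g\<in>polys_over S. f = [:c:] * g \<and> prime_product S k (lead_coeff g))"
        have "lead_coeff f \<in> S" "lead_coeff f \<noteq> 0"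
          using less.prems by (auto intro: polys_over_coeff)
        then obtain k0 where "prime_product S k0 (lead_coeff f)"
          using fact by (auto simp: factorial_in_def)
        then have "Q k0"
          unfolding Q_def using less.prems by (intro bexI[of _ 1] bexI[of _ f]) auto
        define k where "k = (LEAST k. Q k)"
        have "Q k" unfolding k_def using \<open>Q k0\<close> by (rule LeastI)
        then obtain c g where cg: "c \<in> S" "g \<in> polys_over S" "f = [:c:] * g"
          "prime_product S k (lead_coeff g)" unfolding Q_def by blast
        have c0: "c \<noteq> 0" using cg less.prems by auto
        have "prime_in (polys_over S) g"
        proof (rule prime_in_polys_over[OF fact cg(2)])
          show "degree g > 0" using cg deg c0 by auto
          show "\<not> dvd_in (polys_over S) [:p:] g" if p: "prime_in S p" for p
          proof
            assume "dvd_in (polys_over S) [:p:] g"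
            then obtain g' where g': "g' \<in> polys_over S" "g = [:p:] * g'" by (auto simp: dvd_in_def)
            have "p \<in> S" "p \<noteq> 0" using p by (auto simp: prime_in_def)
            then have "lead_coeff g = p * lead_coeff g'"
              by (simp add: g'(2))
            from prime_product_cancel[OF cg(4) p _ this] g'
            have *: "k > 0" "prime_product S (k - 1) (lead_coeff g')"
              by (auto simp: polys_over_coeff)
            have "Q (k - 1)"
              unfolding Q_def using *(2) g' cg(1,3) \<open>p \<in> S\<close>
              by (intro bexI[of _ "c * p"] bexI[of _ g'] conjI mult_closed) (simp_all add: mult.commute)
            then have "k \<le> k - 1" unfolding k_def by (rule Least_le)
            then show False using * by simp
          qed
          show "degree a = 0 \<or> degree b = 0"
            if ab: "a \<in> polys_over S" "b \<in> polys_over S" "g = a * b" for a b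
          proof (rule ccontr)
            assume n: "\<not> ?thesis"
            have "f = ([:c:] * a) * b" using ab cg by (simp add: mult_ac)
            moreover have "degree ([:c:] * a) > 0" using n c0 by auto
            moreover have "[:c:] * a \<in> polys_over S" using cg ab by blast
            ultimately show False using False ab n by blast
          qed
        qed
        then have "prime_product (polys_over S) 1 g" by (rule P.prime_product_prime)
        moreover obtain l where "prime_product (polys_over S) l [:c:]"
          using fact cg(1) c0 prime_product_const unfolding factorial_in_def by blast
        ultimately show ?thesis
          unfolding cg(3) using P.prime_product_mult by blast
      qed
    qed
  qed
  then show ?thesis by (auto simp: factorial_in_def)
qed

end

text \<open>Meant for evaluation at a new variable, which identifies polynomials in one variable
  over \<open>mfps_polys U\<close> with \<open>mfps_polys (insert x U)\<close>.\<close>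

lemma factorial_in_image:
  fixes \<phi> :: "'a::idom \<Rightarrow> 'b::idom"
  assumes fact: "factorial_in S" and sub: "subdomain S" and inj: "inj_on \<phi> S"
    and one: "\<phi> 1 = 1" and zero: "\<phi> 0 = 0"
    and mult: "\<And>a b. a \<in> S \<Longrightarrow> b \<in> S \<Longrightarrow> \<phi> (a * b) = \<phi> a * \<phi> b"
  shows "factorial_in (\<phi> ` S)"
proof -
  interpret subdomain S by (rule sub)
  have dvd: "dvd_in (\<phi> ` S) (\<phi> a) (\<phi> b) \<longleftrightarrow> dvd_in S a b" if "a \<in> S" "b \<in> S" for a b
  proof -
    have "(\<phi> b = \<phi> a * \<phi> c) = (b = a * c)" if "c \<in> S" for c
      using inj_on_eq_iff[OF inj, of b "a * c"] that \<open>a \<in> S\<close> \<open>b \<in> S\<close> by (simp add: mult)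
    then show ?thesis by (auto simp: dvd_in_def)
  qed
  have prime: "prime_in (\<phi> ` S) (\<phi> p)" if p: "prime_in S p" for p
  proof -
    have "p \<in> S" "p \<noteq> 0" using p by (auto simp: prime_in_def)
    moreover have "\<phi> p \<noteq> 0"
      using inj_on_eq_iff[OF inj, of p 0] calculation by (simp add: zero)
    moreover have "\<not> dvd_in (\<phi> ` S) (\<phi> p) 1"
      using dvd[of p 1] p calculation by (simp add: one prime_in_def)
    ultimately show ?thesis
      using p by (auto simp: prime_in_def dvd mult[symmetric])
  qed
  have "prime_product (\<phi> ` S) k (\<phi> a)" if "prime_product S k a" for k a
    using that
  proof (induction rule: prime_product.induct)
    case (unit u)
    then show ?case using dvd[of u 1] by (intro prime_product.unit) (auto simp: one)
  next
    case (step p k a)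
    then have "\<phi> (p * a) = \<phi> p * \<phi> a"
      using prime_product_closed by (intro mult) (auto simp: prime_in_def)
    then show ?case using prime_product.step[OF prime[OF step.hyps(1)] step.IH] by simp
  qed
  moreover have "a \<noteq> 0" if "\<phi> a \<noteq> 0" for a
    using that zero by auto
  ultimately show ?thesis
    using fact unfolding factorial_in_def by blast
qed


section \<open>Polynomial subrings of the power series ring\<close>

lemma mfps_nth_zero [simp]: "mfps_nth 0 i = 0"
  by transfer simp

lemma mfps_nth_one: "mfps_nth 1 i = (if i = 0 then 1 else 0)"
  by transfer simp

lemma mfps_nth_add [simp]: "mfps_nth (f + g) i = mfps_nth f i + mfps_nth g i"
  by transfer simp

lemma mfps_nth_diff [simp]: "mfps_nth (f - g) i = mfps_nth f i - mfps_nth g i"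
  by transfer simp

lemma mfps_nth_mult: "mfps_nth (f * g) k = (\<Sum>(i, j) | i + j = k. mfps_nth f i * mfps_nth g j)"
  by transfer simp

lemma mfps_nth_sum [simp]: "mfps_nth (sum f A) i = (\<Sum>x\<in>A. mfps_nth (f x) i)"
  by (induction A rule: infinite_finite_induct) auto

definition mfps_term :: "'a \<Rightarrow> nat ^ 'n \<Rightarrow> ('a::comm_ring_1, 'n::finite) mfps" where
  "mfps_term c v = Abs_mfps (\<lambda>i. if i = v then c else 0)"

lemma mfps_nth_term [simp]: "mfps_nth (mfps_term c v) i = (if i = v then c else 0)"
  by (simp add: mfps_term_def)

lemma mfps_nth_term_mult:
  "mfps_nth (mfps_term c v * g) i = (if \<forall>k. v $ k \<le> i $ k then c * mfps_nth g (i - v) else 0)"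
proof -
  have "mfps_nth (mfps_term c v * g) i =
    (\<Sum>(u, w) | u + w = i. (if u = v then c * mfps_nth g w else 0))"
    by (auto simp: mfps_nth_mult intro!: sum.cong)
  also have "\<dots> = (\<Sum>(u, w) \<in> {(u, w). u + w = i \<and> u = v}. c * mfps_nth g w)"
    by (rule sum.mono_neutral_cong_right) (auto simp: finite_vec_decompositions split: if_splits)
  also have "{(u, w). u + w = i \<and> u = v} = (if \<forall>k. v $ k \<le> i $ k then {(v, i - v)} else {})"
  proof (cases "\<forall>k. v $ k \<le> i $ k")
    case True
    then show ?thesis by (auto simp: vec_eq_iff) (metis add_diff_cancel_left')
  next
    case False
    then have "i \<noteq> v + w" for w by auto
    then show ?thesis using False by auto
  qed
  finally show ?thesis by (auto split: if_splits)
qed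

lemma mfps_term_mult: "mfps_term c v * mfps_term d w = mfps_term (c * d) (v + w)"
proof (rule mfps_eqI)
  fix i
  show "mfps_nth (mfps_term c v * mfps_term d w) i = mfps_nth (mfps_term (c * d) (v + w)) i"
  proof (cases "\<forall>k. v $ k \<le> i $ k")
    case True
    then have "i - v = w \<longleftrightarrow> i = v + w"
      by (auto simp: vec_eq_iff) (metis le_add_diff_inverse)
    then show ?thesis using True by (simp add: mfps_nth_term_mult)
  next
    case False
    then have "i \<noteq> v + w" by auto
    then show ?thesis using False by (auto simp: mfps_nth_term_mult)
  qed
qed

lemma mfps_term_add: "mfps_term (a + b) v = mfps_term a v + mfps_term b v"
  by (rule mfps_eqI) simp

lemma mfps_term_1: "mfps_term 1 0 = 1"
  by (rule mfps_eqI) (simp add: mfps_nth_one)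

definition mfps_support :: "('a::comm_ring_1, 'n::finite) mfps \<Rightarrow> (nat ^ 'n) set" where
  "mfps_support g = {i. mfps_nth g i \<noteq> 0}"

lemma mfps_support_iff: "i \<in> mfps_support g \<longleftrightarrow> mfps_nth g i \<noteq> 0"
  by (simp add: mfps_support_def)

lemma mfps_support_zero [simp]: "mfps_support 0 = {}"
  by (simp add: mfps_support_def)

lemma mfps_support_empty_iff [simp]: "mfps_support g = {} \<longleftrightarrow> g = 0"
  by (auto simp: mfps_support_def intro: mfps_eqI)

lemma mfps_support_mult_subset:
  "mfps_support (f * g) \<subseteq> (\<lambda>(i, j). i + j) ` (mfps_support f \<times> mfps_support g)"
proof
  fix k assume "k \<in> mfps_support (f * g)"
  then have "(\<Sum>(i, j) | i + j = k. mfps_nth f i * mfps_nth g j) \<noteq> 0"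
    by (simp add: mfps_support_iff mfps_nth_mult)
  then obtain p where "p \<in> {(i, j). i + j = k}" "(case p of (i, j) \<Rightarrow> mfps_nth f i * mfps_nth g j) \<noteq> 0"
    by (rule sum.not_neutral_contains_not_neutral)
  then have "fst p \<in> mfps_support f" "snd p \<in> mfps_support g" "k = (\<lambda>(i, j). i + j) p"
    by (auto simp: mfps_support_iff)
  then show "k \<in> (\<lambda>(i, j). i + j) ` (mfps_support f \<times> mfps_support g)"
    by (intro image_eqI[of _ _ p]) (auto simp: mem_Times_iff)
qed

lemma mfps_support_add_subset: "mfps_support (f + g) \<subseteq> mfps_support f \<union> mfps_support g"
  by (auto simp: mfps_support_iff)

lemma mfps_support_diff_subset: "mfps_support (f - g) \<subseteq> mfps_support f \<union> mfps_support g"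
  by (auto simp: mfps_support_iff)

text \<open>The polynomial rings in all subsets of the variables are subsets of one type, which
  permits induction on \<open>U\<close>: from the constants for \<open>U = {}\<close> to all
  polynomials in \<open>t\<close> for \<open>UNIV\<close>.\<close>

definition mfps_polys :: "'n set \<Rightarrow> ('a::comm_ring_1, 'n::finite) mfps set" where
  "mfps_polys U = {g. finite (mfps_support g) \<and> (\<forall>i\<in>mfps_support g. \<forall>k. k \<notin> U \<longrightarrow> i $ k = 0)}"

lemma mfps_nth_mfps_polys: "g \<in> mfps_polys U \<Longrightarrow> k \<notin> U \<Longrightarrow> i $ k \<noteq> 0 \<Longrightarrow> mfps_nth g i = 0"
  by (auto simp: mfps_polys_def mfps_support_def)

lemma mfps_polys_UNIV: "g \<in> mfps_polys UNIV \<longleftrightarrow> finite (mfps_support g)"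
  by (simp add: mfps_polys_def)

lemma subdomain_mfps_polys: "subdomain (mfps_polys U :: ('a::idom, 'n::finite) mfps set)"
proof
  show "1 \<in> (mfps_polys U :: ('a::idom, 'n::finite) mfps set)"
    by (auto simp: mfps_polys_def mfps_support_def mfps_nth_one)
  fix f g :: "('a, 'n) mfps"
  assume f: "f \<in> mfps_polys U" and g: "g \<in> mfps_polys U"
  then show "f - g \<in> mfps_polys U"
    using mfps_support_diff_subset[of f g] by (fastforce simp: mfps_polys_def dest: finite_subset)
  have "i $ k = 0" if i: "i \<in> mfps_support (f * g)" and k: "k \<notin> U" for i k
  proof -
    obtain u v where "i = u + v" "u \<in> mfps_support f" "v \<in> mfps_support g"
      using subsetD[OF mfps_support_mult_subset i] by auto
    then show ?thesis
      using f g k by (auto simp: mfps_polys_def)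
  qed
  moreover have "finite (mfps_support (f * g))"
    using f g by (intro finite_subset[OF mfps_support_mult_subset]) (auto simp: mfps_polys_def)
  ultimately show "f * g \<in> mfps_polys U"
    by (auto simp: mfps_polys_def)
qed

section \<open>Adjoining one variable by evaluation\<close>

lemma mfps_var_power:
  "mfps_term 1 (axis x 1) ^ j = (mfps_term 1 (axis x j) :: ('a::comm_ring_1, 'n::finite) mfps)"
proof (induction j)
  case 0
  have *: "axis x 0 = (0 :: nat ^ 'n)" by (simp add: vec_eq_iff axis_def)
  show ?case unfolding * by (simp add: mfps_term_1)
next
  case (Suc j)
  have "axis x 1 + axis x j = (axis x (Suc j) :: nat ^ 'n)"
    by (simp add: vec_eq_iff axis_def)
  then show ?case by (simp add: Suc mfps_term_mult del: One_nat_def)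
qed

text \<open>The coefficients of \<open>p\<close> do not involve \<open>x\<close>, so the power of
  \<open>x\<close> in a monomial reveals the one coefficient of \<open>p\<close> from which it
  comes.\<close>

lemma mfps_nth_poly_var:
  fixes p :: "('a::idom, 'n::finite) mfps poly"
  assumes "p \<in> polys_over (mfps_polys U)" "x \<notin> U"
  shows "mfps_nth (poly p (mfps_term 1 (axis x 1))) i = mfps_nth (coeff p (i $ x)) (i - axis x (i $ x))"
proof -
  have zero: "mfps_nth (coeff p j) v = 0" if "v $ x \<noteq> 0" for j v
    using mfps_nth_mfps_polys[OF polys_over_coeff[OF assms(1)] assms(2)] that by blast
  have le: "(\<forall>k. axis x j $ k \<le> i $ k) \<longleftrightarrow> j \<le> i $ x" for j
    by (auto simp: axis_def)
  have "mfps_nth (poly p (mfps_term 1 (axis x 1))) i =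
    (\<Sum>j\<le>degree p. mfps_nth (mfps_term 1 (axis x j) * coeff p j) i)"
    by (simp add: poly_altdef mfps_var_power mult.commute del: One_nat_def)
  also have "\<dots> = (\<Sum>j\<le>degree p. if j = i $ x then mfps_nth (coeff p (i $ x)) (i - axis x (i $ x)) else 0)"
    by (rule sum.cong) (auto simp: mfps_nth_term_mult le axis_def intro!: zero)
  also have "\<dots> = mfps_nth (coeff p (i $ x)) (i - axis x (i $ x))"
    by (auto simp: sum.delta coeff_eq_0)
  finally show ?thesis .
qed

lemma inj_on_poly_var:
  fixes U :: "'n::finite set"
  assumes "x \<notin> U"
  shows "inj_on (\<lambda>p. poly p (mfps_term 1 (axis x 1)))
           (polys_over (mfps_polys U) :: ('a::idom, 'n) mfps poly set)"
proof (rule inj_onI)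
  fix p r :: "('a, 'n) mfps poly"
  assume p: "p \<in> polys_over (mfps_polys U)" and r: "r \<in> polys_over (mfps_polys U)"
    and eq: "poly p (mfps_term 1 (axis x 1)) = poly r (mfps_term 1 (axis x 1))"
  have "mfps_nth (coeff p j) i = mfps_nth (coeff r j) i" for i j
  proof (cases "i $ x = 0")
    case True
    define v where "v = i + axis x j"
    have "v $ x = j" "v - axis x j = i"
      using True by (auto simp: v_def vec_eq_iff axis_def)
    then show ?thesis
      using arg_cong[OF eq, of "\<lambda>g. mfps_nth g v"] mfps_nth_poly_var[OF p assms, of v]
        mfps_nth_poly_var[OF r assms, of v] by simp
  next
    case False
    then show ?thesis
      using mfps_nth_mfps_polys[OF polys_over_coeff[OF p] assms]
        mfps_nth_mfps_polys[OF polys_over_coeff[OF r] assms] by simp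
  qed
  then show "p = r"
    by (auto simp: poly_eq_iff intro: mfps_eqI)
qed

lemma poly_var_image:
  fixes U :: "'n::finite set"
  assumes "x \<notin> U"
  shows "(\<lambda>p. poly p (mfps_term 1 (axis x 1))) ` polys_over (mfps_polys U) =
           (mfps_polys (insert x U) :: ('a::idom, 'n) mfps set)"
proof (intro equalityI subsetI)
  interpret subdomain "mfps_polys (insert x U) :: ('a, 'n) mfps set"
    by (rule subdomain_mfps_polys)
  fix g :: "('a, 'n) mfps"
  assume "g \<in> (\<lambda>p. poly p (mfps_term 1 (axis x 1))) ` polys_over (mfps_polys U)"
  then obtain p where p: "p \<in> polys_over (mfps_polys U)" and g: "g = poly p (mfps_term 1 (axis x 1))"
    by blast
  have "coeff p j \<in> mfps_polys (insert x U)" for j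
    using polys_over_coeff[OF p, of j] by (auto simp: mfps_polys_def)
  moreover have "mfps_term 1 (axis x 1) \<in> (mfps_polys (insert x U) :: ('a, 'n) mfps set)"
    by (auto simp: mfps_polys_def mfps_support_def axis_def)
  ultimately show "g \<in> mfps_polys (insert x U)"
    unfolding g poly_altdef by (intro sum_closed mult_closed power_closed)
next
  fix g :: "('a, 'n) mfps"
  assume g: "g \<in> mfps_polys (insert x U)"
  \<comment> \<open>Regard \<open>g\<close> as a polynomial in the variable \<open>x\<close>;
    \<open>c j\<close> is its coefficient at the \<open>j\<close>-th power.\<close>
  define c where "c = (\<lambda>j. Abs_mfps (\<lambda>i. if i $ x = 0 then mfps_nth g (i + axis x j) else 0))"
  have fin: "finite (mfps_support g)" using g by (simp add: mfps_polys_def)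
  then have "finite ((\<lambda>i. i $ x) ` mfps_support g)" by blast
  then obtain D where D: "\<And>i. i \<in> mfps_support g \<Longrightarrow> i $ x \<le> D"
    by (meson Max_ge imageI)
  have c0: "c j = 0" if "j > D" for j
  proof (rule mfps_eqI)
    fix i
    have "i + axis x j \<notin> mfps_support g" if "i $ x = 0"
      using D[of "i + axis x j"] \<open>j > D\<close> that by (auto simp: axis_def)
    then show "mfps_nth (c j) i = mfps_nth 0 i"
      by (auto simp: c_def mfps_support_iff)
  qed
  define p where "p = (\<Sum>j\<le>D. monom (c j) j)"
  have coeff_p: "coeff p j = c j" for j
    by (auto simp: p_def coeff_sum coeff_monom c0 sum.delta)
  have "c j \<in> mfps_polys U" for j
  proof -
    have sub: "mfps_support (c j) \<subseteq> (\<lambda>v. v - axis x j) ` mfps_support g"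
    proof
      fix i assume "i \<in> mfps_support (c j)"
      then have "i + axis x j \<in> mfps_support g" "i = (i + axis x j) - axis x j"
        by (auto simp: c_def mfps_support_iff vec_eq_iff split: if_splits)
      then show "i \<in> (\<lambda>v. v - axis x j) ` mfps_support g" by blast
    qed
    have "i $ k = 0" if "i \<in> mfps_support (c j)" "k \<notin> U" for i k
    proof (cases "k = x")
      case True
      then show ?thesis using that by (auto simp: c_def mfps_support_iff split: if_splits)
    next
      case False
      have "i + axis x j \<in> mfps_support g"
        using that by (auto simp: c_def mfps_support_iff split: if_splits)
      then have "(i + axis x j) $ k = 0"
        using g that False unfolding mfps_polys_def by blast
      then show ?thesis by simp
    qed
    then show ?thesis
      using finite_subset[OF sub] fin by (auto simp: mfps_polys_def)
  qed
  then have p: "p \<in> polys_over (mfps_polys U)"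
    by (simp add: polys_over_def coeff_p)
  have "poly p (mfps_term 1 (axis x 1)) = g"
  proof (rule mfps_eqI)
    fix i :: "nat ^ 'n"
    have "i - axis x (i $ x) + axis x (i $ x) = i" "(i - axis x (i $ x)) $ x = 0"
      by (auto simp: vec_eq_iff axis_def)
    then show "mfps_nth (poly p (mfps_term 1 (axis x 1))) i = mfps_nth g i"
      unfolding mfps_nth_poly_var[OF p assms] coeff_p by (simp add: c_def)
  qed
  then show "g \<in> (\<lambda>p. poly p (mfps_term 1 (axis x 1))) ` polys_over (mfps_polys U)"
    using p by blast
qed

lemma factorial_in_mfps_polys:
  fixes U :: "'n::finite set"
  shows "factorial_in (mfps_polys U :: ('a::field, 'n) mfps set)"
proof (induction U rule: finite_induct[OF finite_class.finite])
  case 1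
  have "prime_product (mfps_polys {}) 0 g" if g: "g \<in> mfps_polys {}" "g \<noteq> 0" for g :: "('a, 'n) mfps"
  proof -
    have sub: "mfps_support g \<subseteq> {0}"
      using g by (auto simp: mfps_polys_def vec_eq_iff)
    define c where "c = mfps_nth g 0"
    have "g = mfps_term c 0"
      using sub by (intro mfps_eqI) (auto simp: mfps_support_iff c_def)
    moreover have "c \<noteq> 0"
      using calculation g(2) by (auto intro!: mfps_eqI)
    moreover have "mfps_term (inverse c) 0 \<in> (mfps_polys {} :: ('a, 'n) mfps set)"
      by (auto simp: mfps_polys_def mfps_support_def)
    ultimately show ?thesis
      using g by (intro prime_product.unit dvd_inI[of "mfps_term (inverse c) 0"])
        (auto simp: mfps_term_mult mfps_term_1)
  qed
  then show ?case by (auto simp: factorial_in_def)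
next
  case (2 x U)
  interpret subdomain "mfps_polys U :: ('a, 'n) mfps set"
    by (rule subdomain_mfps_polys)
  have "factorial_in ((\<lambda>p. poly p (mfps_term 1 (axis x 1))) ` polys_over (mfps_polys U :: ('a, 'n) mfps set))"
    using 2 by (intro factorial_in_image factorial_in_polys_over subdomain_polys_over inj_on_poly_var) auto
  then show ?case
    unfolding poly_var_image[OF 2(2)] .
qed


section \<open>Sections over a finite field\<close>

lemma power_card_eq_same: "(x :: 'a::{field, finite}) ^ CARD('a) = x"
proof (cases "x = 0")
  case False
  have "x ^ card (UNIV - {0} :: 'a set) * \<Prod>(UNIV - {0 :: 'a}) = (\<Prod>y\<in>UNIV - {0}. x * y)"
    by (simp add: prod.distrib)
  also have "\<dots> = \<Prod>(UNIV - {0})"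
    by (rule prod.reindex_bij_witness[of _ "\<lambda>y. y / x" "\<lambda>y. x * y"]) (use False in auto)
  finally have pow: "x ^ card (UNIV - {0} :: 'a set) = 1"
    by simp
  have card: "CARD('a) = Suc (card (UNIV - {0} :: 'a set))"
    by (rule card.remove) auto
  show ?thesis
    unfolding card power_Suc pow by simp
qed (simp add: card_gt_0_iff)

text \<open>Sylow's theorem gives an additive subgroup of order \<open>l\<close>. A nonzero element
  of it is killed by \<open>l\<close>, so the characteristic divides the prime
  \<open>l\<close>.\<close>

lemma prime_dvd_card_eq_CHAR:
  assumes l: "prime l" "l dvd CARD('a::{field, finite})"
  shows "l = CHAR('a)"
proof -
  define G :: "'a monoid" where "G = \<lparr>carrier = UNIV, monoid.mult = (+), one = 0\<rparr>"
  have G: "group G"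
    by (rule groupI) (auto simp: G_def add.assoc intro: exI[of _ "- x" for x])
  have pow: "x [^]\<^bsub>G\<^esub> n = of_nat n * x" for x n
    using G by (induction n) (auto simp: G_def nat_pow_def algebra_simps)
  obtain m where m: "CARD('a) = l ^ 1 * m"
    using l(2) by (auto simp: dvd_def)
  have "Coset.order G = l ^ 1 * m"
    using m by (simp add: Coset.order_def G_def)
  from sylow_thm[OF l(1) G this] obtain H where H: "subgroup H G" "card H = l"
    by (auto simp: G_def)
  have "card H > 1"
    using H l(1) prime_gt_1_nat by simp
  then have "\<not> H \<subseteq> {0}"
    using card_mono[of "{0}" H] by auto
  then obtain x where x: "x \<in> H" "x \<noteq> 0"
    by auto
  interpret H: group "G\<lparr>carrier := H\<rparr>"
    using G H(1) by (simp add: group.subgroup_imp_group)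
  have "x [^]\<^bsub>G\<lparr>carrier := H\<rparr>\<^esub> Coset.order (G\<lparr>carrier := H\<rparr>) = \<one>\<^bsub>G\<lparr>carrier := H\<rparr>\<^esub>"
    using x by (intro H.pow_order_eq_1) simp
  then have "x [^]\<^bsub>G\<^esub> l = 0"
    using H by (simp add: Coset.order_def G_def nat_pow_def)
  then have "of_nat l = (0 :: 'a)"
    using x by (simp add: pow)
  then have "CHAR('a) dvd l"
    by (simp add: of_nat_eq_0_iff_char_dvd)
  moreover have "CHAR('a) \<noteq> 1"
    by (metis of_nat_1 of_nat_CHAR zero_neq_one)
  ultimately show ?thesis
    using l(1) by (metis prime_nat_iff)
qed

lemma card_eq_CHAR_power:
  obtains e where "CARD('a::{field, finite}) = CHAR('a) ^ Suc e" "prime CHAR('a)"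
proof -
  have "CARD('a) > 1"
    using card_mono[of "UNIV :: 'a set" "{0, 1}"] by simp
  then obtain l where "prime l" "l dvd CARD('a)"
    by (metis less_irrefl prime_factor_nat)
  then have p: "prime CHAR('a)" "CHAR('a) dvd CARD('a)"
    using prime_dvd_card_eq_CHAR by metis+
  obtain m where m: "CARD('a) = CHAR('a) ^ multiplicity CHAR('a) CARD('a) * m" "\<not> CHAR('a) dvd m"
    using multiplicity_decompose'[of "CARD('a)" "CHAR('a)"] p(1) \<open>CARD('a) > 1\<close> not_prime_unit
    by auto
  have "m = 1"
  proof (rule ccontr)
    assume "m \<noteq> 1"
    then obtain l where "prime l" "l dvd m" using prime_factor_nat by blast
    then show False
      using prime_dvd_card_eq_CHAR[of l, where ?'a = 'a] m(2) dvd_trans[of l m "CARD('a)"]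
        dvdI[OF m(1)[unfolded mult.commute[of _ m]]] by blast
  qed
  with m(1) have eq: "CARD('a) = CHAR('a) ^ multiplicity CHAR('a) CARD('a)"
    by simp
  have "multiplicity CHAR('a) CARD('a) \<noteq> 0"
  proof
    assume "multiplicity CHAR('a) CARD('a) = 0"
    with eq have "CARD('a) = 1" by simp
    with \<open>CARD('a) > 1\<close> show False by simp
  qed
  then obtain e where "multiplicity CHAR('a) CARD('a) = Suc e"
    using not0_implies_Suc by blast
  with eq have "CARD('a) = CHAR('a) ^ Suc e" by simp
  then show ?thesis
    using that p(1) by blast
qed

lemma of_nat_mfps: "of_nat m = mfps_term (of_nat m) 0"
proof (induction m)
  case 0
  show ?case by (rule mfps_eqI) simp
next
  case (Suc m)
  then show ?case by (auto intro!: mfps_eqI simp: mfps_nth_one)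
qed

lemma CHAR_mfps [simp]: "CHAR(('a::comm_ring_1, 'n::finite) mfps) = CHAR('a)"
proof (rule CHAR_eqI)
  show "of_nat CHAR('a) = (0 :: ('a, 'n) mfps)"
    by (rule mfps_eqI) (simp add: of_nat_mfps)
next
  fix m assume "of_nat m = (0 :: ('a, 'n) mfps)"
  then have "mfps_nth (of_nat m :: ('a, 'n) mfps) 0 = 0" by simp
  then show "CHAR('a) dvd m"
    by (simp add: of_nat_mfps of_nat_eq_0_iff_char_dvd)
qed

lemma freshmans_dream_card_mfps:
  fixes f g :: "('a::{field, finite}, 'n::finite) mfps"
  shows "(f + g) ^ CARD('a) = f ^ CARD('a) + g ^ CARD('a)"
proof -
  obtain e where "CARD('a) = CHAR('a) ^ Suc e" "prime CHAR('a)"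
    by (rule card_eq_CHAR_power)
  then show ?thesis
    by (intro freshmans_dream'[of _ "Suc e"]) simp_all
qed

lemma freshmans_dream_card_mfps_sum:
  fixes f :: "'b \<Rightarrow> ('a::{field, finite}, 'n::finite) mfps"
  shows "sum f A ^ CARD('a) = (\<Sum>x\<in>A. f x ^ CARD('a))"
proof -
  obtain e where "CARD('a) = CHAR('a) ^ Suc e" "prime CHAR('a)"
    by (rule card_eq_CHAR_power)
  then show ?thesis
    by (intro freshmans_dream_sum'[of _ "Suc e"]) simp_all
qed

lemma freshmans_dream_card_mfps_poly:
  fixes f g :: "('a::{field, finite}, 'n::finite) mfps poly"
  shows "(f + g) ^ CARD('a) = f ^ CARD('a) + g ^ CARD('a)"
proof -
  obtain e where "CARD('a) = CHAR('a) ^ Suc e" "prime CHAR('a)"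
    by (rule card_eq_CHAR_power)
  then show ?thesis
    by (intro freshmans_dream'[of _ "Suc e"]) simp_all
qed

lemma mfps_term_power: "mfps_term c v ^ m = mfps_term (c ^ m) (\<chi> k. m * v $ k)"
proof (induction m)
  case 0
  have "(\<chi> k. 0 * v $ k) = 0" by (simp add: vec_eq_iff)
  then show ?case by (simp add: mfps_term_1)
next
  case (Suc m)
  have "v + (\<chi> k. m * v $ k) = (\<chi> k. Suc m * v $ k)" by (simp add: vec_eq_iff)
  then show ?case by (simp add: Suc mfps_term_mult)
qed

text \<open>\<open>g ^ q\<close> is \<open>g\<close> with every variable raised to the power
  \<open>q\<close>. For the coefficient at \<open>v\<close>, cut \<open>g\<close> down to the
  finitely many exponents below \<open>v\<close>: on this finite sum Frobenius acts termwise, and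
  the remainder has no exponent below \<open>v\<close> and cannot contribute.\<close>

lemma mfps_nth_power_card:
  fixes g :: "('a::{field, finite}, 'n::finite) mfps"
  shows "mfps_nth (g ^ CARD('a)) (\<chi> k. CARD('a) * i $ k) = mfps_nth g i"
    and "(\<nexists>i. v = (\<chi> k. CARD('a) * i $ k)) \<Longrightarrow> mfps_nth (g ^ CARD('a)) v = 0"
proof -
  have q: "CARD('a) > 0" by (simp add: card_gt_0_iff)
  have main: "mfps_nth (g ^ CARD('a)) v =
    (\<Sum>u | \<forall>k. u $ k \<le> v $ k. if v = (\<chi> k. CARD('a) * u $ k) then mfps_nth g u else 0)" for v
  proof -
    define B where "B = {u :: nat ^ 'n. \<forall>k. u $ k \<le> v $ k}"
    have "finite ((\<lambda>(i, j). i) ` {(i, j). i + j = v})"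
      by (intro finite_imageI finite_vec_decompositions)
    moreover have "B \<subseteq> (\<lambda>(i, j). i) ` {(i, j). i + j = v}"
    proof
      fix u assume "u \<in> B"
      then have "u + (v - u) = v" by (auto simp: B_def vec_eq_iff)
      then show "u \<in> (\<lambda>(i, j). i) ` {(i, j). i + j = v}" by force
    qed
    ultimately have finB: "finite B" by (rule finite_subset[rotated])
    define g0 where "g0 = (\<Sum>u\<in>B. mfps_term (mfps_nth g u) u)"
    define g1 where "g1 = g - g0"
    have nth_g0: "mfps_nth g0 u = mfps_nth g u" if "u \<in> B" for u
      using that finB by (simp add: g0_def sum.delta)
    have vanish: "mfps_nth (g1 * h) v = 0" for h
      unfolding mfps_nth_mult
      by (rule sum.neutral) (auto simp: g1_def B_def intro!: nth_g0[symmetric])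
    have "g1 ^ CARD('a) = g1 * g1 ^ (CARD('a) - 1)"
      using q by (simp add: power_eq_if)
    then have "mfps_nth (g1 ^ CARD('a)) v = 0"
      by (simp add: vanish)
    moreover have "g ^ CARD('a) = g0 ^ CARD('a) + g1 ^ CARD('a)"
      using freshmans_dream_card_mfps[of g0 g1] by (simp add: g1_def)
    ultimately show ?thesis
      by (simp add: g0_def freshmans_dream_card_mfps_sum mfps_term_power power_card_eq_same B_def)
  qed
  show "mfps_nth (g ^ CARD('a)) v = 0" if "\<nexists>i. v = (\<chi> k. CARD('a) * i $ k)"
    unfolding main using that by (intro sum.neutral) auto
  have inj: "(\<chi> k. CARD('a) * i $ k) = (\<chi> k. CARD('a) * u $ k) \<longleftrightarrow> u = i" for u
    using q by (auto simp: vec_eq_iff)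
  have "finite ((\<lambda>(i, j). i) ` {(u, j). u + j = (\<chi> k. CARD('a) * i $ k)})"
    by (intro finite_imageI finite_vec_decompositions)
  then have "finite {u :: nat ^ 'n. \<forall>k. u $ k \<le> (\<chi> k. CARD('a) * i $ k) $ k}"
  proof (rule finite_subset[rotated], safe)
    fix u :: "nat ^ 'n" assume "\<forall>k. u $ k \<le> (\<chi> k. CARD('a) * i $ k) $ k"
    then have "u + ((\<chi> k. CARD('a) * i $ k) - u) = (\<chi> k. CARD('a) * i $ k)"
      by (auto simp: vec_eq_iff)
    then show "u \<in> (\<lambda>(i, j). i) ` {(u, j). u + j = (\<chi> k. CARD('a) * i $ k)}" by force
  qed
  then show "mfps_nth (g ^ CARD('a)) (\<chi> k. CARD('a) * i $ k) = mfps_nth g i"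
    unfolding main inj using q by (subst sum.delta) auto
qed

section \<open>Section operators on power series\<close>

definition mfps_section :: "nat \<Rightarrow> nat ^ 'n \<Rightarrow> ('a::comm_ring_1, 'n::finite) mfps \<Rightarrow> ('a, 'n) mfps" where
  "mfps_section q r g = Abs_mfps (\<lambda>i. mfps_nth g (\<chi> k. q * i $ k + r $ k))"

lemma mfps_nth_section [simp]:
  "mfps_nth (mfps_section q r g) i = mfps_nth g (\<chi> k. q * i $ k + r $ k)"
  by (simp add: mfps_section_def)

lemma mfps_section_zero [simp]: "mfps_section q r 0 = 0"
  by (rule mfps_eqI) simp

lemma mfps_section_add: "mfps_section q r (f + g) = mfps_section q r f + mfps_section q r g"
  by (rule mfps_eqI) simp

lemma mfps_section_diff: "mfps_section q r (f - g) = mfps_section q r f - mfps_section q r g"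
  by (rule mfps_eqI) simp

lemma mfps_section_sum: "mfps_section q r (sum f A) = (\<Sum>x\<in>A. mfps_section q r (f x))"
  by (rule mfps_eqI) simp

text \<open>\<open>g ^ q\<close> lives on exponents divisible by \<open>q\<close>. Among the
  decompositions of \<open>q * i + r\<close> only the pairs \<open>(q * a, q * b + r)\<close>
  contribute, because the entries of \<open>r\<close> are digits.\<close>

lemma mfps_section_power_card_mult:
  fixes g u :: "('a::{field, finite}, 'n::finite) mfps"
  assumes r: "r \<in> digit_vectors CARD('a)"
  shows "mfps_section CARD('a) r (g ^ CARD('a) * u) = g * mfps_section CARD('a) r u"
proof (rule mfps_eqI)
  fix i :: "nat ^ 'n"
  let ?q = "CARD('a)"
  define w where "w = (\<chi> k. ?q * i $ k + r $ k)"
  have q: "?q > 0" by (simp add: card_gt_0_iff)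
  have r': "r $ k < ?q" for k using r by (simp add: digit_vectors_def)
  define \<phi> where "\<phi> = (\<lambda>(a, b). ((\<chi> k. ?q * a $ k) :: nat ^ 'n, (\<chi> k. ?q * b $ k + r $ k) :: nat ^ 'n))"
  have inj: "inj_on \<phi> {(a, b). a + b = i}"
    using q by (auto simp: inj_on_def \<phi>_def vec_eq_iff)
  have "mfps_nth (mfps_section ?q r (g ^ ?q * u)) i =
    (\<Sum>(a, b) | a + b = w. mfps_nth (g ^ ?q) a * mfps_nth u b)"
    by (simp add: w_def[symmetric] mfps_nth_mult)
  also have "\<dots> = (\<Sum>(a, b) \<in> \<phi> ` {(a, b). a + b = i}. mfps_nth (g ^ ?q) a * mfps_nth u b)"
  proof (rule sum.mono_neutral_right)
    show "\<phi> ` {(a, b). a + b = i} \<subseteq> {(a, b). a + b = w}"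
      by (auto simp: \<phi>_def w_def vec_eq_iff simp flip: distrib_left)
    show "\<forall>x\<in>{(a, b). a + b = w} - \<phi> ` {(a, b). a + b = i}.
      (case x of (a, b) \<Rightarrow> mfps_nth (g ^ ?q) a * mfps_nth u b) = 0"
    proof clarify
      fix a b assume w: "w = a + b" and n: "(a, b) \<notin> \<phi> ` {(a, b). a + b = i}"
      have "\<nexists>a'. a = (\<chi> k. ?q * a' $ k)"
      proof
        assume "\<exists>a'. a = (\<chi> k. ?q * a' $ k)"
        then obtain a' where a': "a = (\<chi> k. ?q * a' $ k)" by blast
        have eq: "?q * i $ k + r $ k = ?q * a' $ k + b $ k" for k
          using arg_cong[OF w, of "\<lambda>v. v $ k"] a' by (simp add: w_def)
        have le: "a' $ k \<le> i $ k" for k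
        proof (rule ccontr)
          assume "\<not> a' $ k \<le> i $ k"
          then have "?q * Suc (i $ k) \<le> ?q * a' $ k" by (intro mult_le_mono) auto
          then show False using eq[of k] r'[of k] by simp
        qed
        have "b $ k = ?q * (i $ k - a' $ k) + r $ k" for k
          using eq[of k] mult_le_mono2[OF le[of k], of ?q] by (simp add: diff_mult_distrib2)
        then have "(a, b) = \<phi> (a', i - a')"
          by (simp add: \<phi>_def a' vec_eq_iff)
        moreover have "a' + (i - a') = i" using le by (simp add: vec_eq_iff)
        ultimately show False using n by blast
      qed
      then show "mfps_nth (g ^ ?q) a * mfps_nth u b = 0"
        by (simp add: mfps_nth_power_card(2))
    qed
  qed (rule finite_vec_decompositions)
  also have "\<dots> = (\<Sum>(a, b) | a + b = i. mfps_nth g a * mfps_nth (mfps_section ?q r u) b)"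
    by (subst sum.reindex[OF inj]) (auto simp: \<phi>_def mfps_nth_power_card(1) intro!: sum.cong)
  also have "\<dots> = mfps_nth (g * mfps_section ?q r u) i"
    by (simp add: mfps_nth_mult)
  finally show "mfps_nth (mfps_section ?q r (g ^ ?q * u)) i = mfps_nth (g * mfps_section ?q r u) i" .
qed

text \<open>The Cartier operator on differentials \<open>P dy\<close>: it maps
  \<open>y ^ (q * j + q - 1) dy\<close> to \<open>y ^ j dy\<close>, kills the other powers of
  \<open>y\<close>, and takes sections of the coefficients. Summing up to the degree of
  \<open>P\<close> suffices, as \<open>j \<le> q * j + q - 1\<close>.\<close>

definition poly_section ::
    "nat \<Rightarrow> nat ^ 'n \<Rightarrow> ('a::comm_ring_1, 'n::finite) mfps poly \<Rightarrow> ('a, 'n) mfps poly" where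
  "poly_section q r P =
     (\<Sum>j\<le>Polynomial.degree P. Polynomial.monom (mfps_section q r (Polynomial.coeff P (q * j + q - 1))) j)"

lemma coeff_poly_section:
  assumes "q > 0"
  shows "Polynomial.coeff (poly_section q r P) j = mfps_section q r (Polynomial.coeff P (q * j + q - 1))"
proof -
  have "j \<le> q * j" using assms by simp
  then have "Polynomial.coeff P (q * j + q - 1) = 0" if "j > Polynomial.degree P"
    using that assms by (intro coeff_eq_0) linarith
  then show ?thesis
    by (auto simp: poly_section_def coeff_sum sum.delta)
qed

lemma poly_section_add:
  "q > 0 \<Longrightarrow> poly_section q r (P + Q) = poly_section q r P + poly_section q r Q"
  by (simp add: poly_eq_iff coeff_poly_section mfps_section_add)

text \<open>By Frobenius \<open>(y - f) ^ q = y ^ q - f ^ q\<close>. The factor \<open>y ^ q\<close>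
  shifts the section by one index and \<open>f ^ q\<close> leaves it as \<open>f\<close>. In
  particular, multiples of \<open>(y - f) ^ q\<close> have sections that vanish at
  \<open>y = f\<close>.\<close>

lemma poly_section_linear_power_mult:
  fixes f :: "('a::{field, finite}, 'n::finite) mfps"
  assumes r: "r \<in> digit_vectors CARD('a)"
  shows "poly_section CARD('a) r ([:- f, 1:] ^ CARD('a) * H) = [:- f, 1:] * poly_section CARD('a) r H"
proof -
  let ?q = "CARD('a)"
  have q: "?q > 0" by (simp add: card_gt_0_iff)
  have "[:- f, 1:] + [:f:] = (Polynomial.monom 1 1 :: ('a, 'n) mfps poly)"
    by (simp add: monom_altdef)
  then have "[:- f, 1:] ^ ?q + [:f:] ^ ?q = (Polynomial.monom 1 1 :: ('a, 'n) mfps poly) ^ ?q"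
    by (metis freshmans_dream_card_mfps_poly)
  then have pow: "[:- f, 1:] ^ ?q = Polynomial.monom 1 ?q - [:f ^ ?q:]"
    by (simp add: monom_power poly_const_pow algebra_simps)
  show ?thesis
  proof (rule poly_eqI)
    fix j
    have "Polynomial.coeff ([:- f, 1:] ^ ?q * H) (?q * j + ?q - 1) =
      (if j = 0 then 0 else Polynomial.coeff H (?q * (j - 1) + ?q - 1)) -
      f ^ ?q * Polynomial.coeff H (?q * j + ?q - 1)"
    proof (cases j)
      case 0
      then show ?thesis using q by (simp add: pow left_diff_distrib coeff_monom_mult)
    next
      case (Suc j')
      have "?q * Suc j' + ?q - 1 - ?q = ?q * j' + ?q - 1" by simp
      then show ?thesis using q Suc by (simp add: pow left_diff_distrib coeff_monom_mult)
    qed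
    then show "Polynomial.coeff (poly_section ?q r ([:- f, 1:] ^ ?q * H)) j =
      Polynomial.coeff ([:- f, 1:] * poly_section ?q r H) j"
      using q by (simp add: coeff_poly_section mfps_section_diff mfps_section_power_card_mult[OF r]
          coeff_pCons split: nat.splits)
  qed
qed

text \<open>\<open>(y - f) ^ (q - 1)\<close> is monic of degree \<open>q - 1\<close>, so of the
  selected exponents only \<open>q - 1\<close> occurs. This is the term that carries the
  residue.\<close>

lemma poly_section_linear_power_pred:
  fixes f c :: "('a::comm_ring_1, 'n::finite) mfps"
  assumes q: "q > 0"
  shows "poly_section q r ([:- f, 1:] ^ (q - 1) * [:c:]) = [:mfps_section q r c:]"
proof (rule poly_eqI)
  fix j
  have "Polynomial.coeff ([:- f, 1:] ^ (q - 1)) (q * j + q - 1) = (if j = 0 then 1 else 0)"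
  proof (cases "j = 0")
    case True
    then show ?thesis using coeff_linear_power[of "- f" "q - 1"] by simp
  next
    case False
    have "Polynomial.degree ([:- f, 1:] ^ (q - 1)) \<le> q - 1"
      using degree_power_le[of "[:- f, 1:]" "q - 1"] by simp
    moreover have "q - 1 < q * j + q - 1" using False q by (cases j) auto
    ultimately show ?thesis using False by (simp add: coeff_eq_0)
  qed
  then show "Polynomial.coeff (poly_section q r ([:- f, 1:] ^ (q - 1) * [:c:])) j =
    Polynomial.coeff [:mfps_section q r c:] j"
    using q by (auto simp: coeff_poly_section coeff_pCons split: nat.splits)
qed

text \<open>If \<open>E = (y - f) G\<close>, the element \<open>P(f) / G(f)\<close> is the residue of \<open>P / E\<close> at \<open>y = f\<close>, and
  \<open>P / E = P E\<^sup>q\<^sup>-\<^sup>1 / E\<^sup>q\<close>. The lemma says that sections commute with this residue.\<close>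

lemma section_residue:
  fixes f g :: "('a::{field, finite}, 'n::finite) mfps"
  assumes r: "r \<in> digit_vectors CARD('a)"
    and E: "E = [:- f, 1:] * G"
    and g: "g * poly G f = poly P f"
  shows "mfps_section CARD('a) r g * poly G f = poly (poly_section CARD('a) r (P * E ^ (CARD('a) - 1))) f"
proof -
  let ?q = "CARD('a)"
  have q: "?q > 0" by (simp add: card_gt_0_iff)
  \<comment> \<open>Only the value \<open>c\<close> at \<open>y = f\<close> matters: the rest of
    \<open>P * G ^ (q - 1)\<close> is a multiple of \<open>y - f\<close>. Together with the factor
    \<open>(y - f) ^ (q - 1)\<close> it becomes a multiple of \<open>(y - f) ^ q\<close>, whose
    section vanishes at \<open>f\<close>.\<close>
  define c where "c = poly (P * G ^ (?q - 1)) f"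
  have "poly (P * G ^ (?q - 1) - [:c:]) f = 0" by (simp add: c_def)
  then obtain H where H: "P * G ^ (?q - 1) - [:c:] = [:- f, 1:] * H"
    unfolding poly_eq_0_iff_dvd by (elim dvdE)
  have "P * E ^ (?q - 1) = [:- f, 1:] ^ (?q - 1) * ((P * G ^ (?q - 1) - [:c:]) + [:c:])"
    unfolding E power_mult_distrib by (simp only: diff_add_cancel mult_ac)
  also have "\<dots> = [:- f, 1:] ^ Suc (?q - 1) * H + [:- f, 1:] ^ (?q - 1) * [:c:]"
    unfolding H by (simp only: distrib_left power_Suc mult_ac)
  also have "Suc (?q - 1) = ?q" using q by simp
  finally have "poly (poly_section ?q r (P * E ^ (?q - 1))) f = mfps_section ?q r c"
    by (simp only: poly_section_add[OF q] poly_section_linear_power_mult[OF r]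
        poly_section_linear_power_pred[OF q] poly_add poly_mult) simp
  \<comment> \<open>The value of \<open>P\<close> supplies the missing factor
    \<open>poly G f\<close>. The resulting full \<open>q\<close>-th power leaves the section as
    \<open>poly G f\<close>.\<close>
  also have "c = g * poly G f ^ Suc (?q - 1)"
    by (simp only: c_def poly_mult poly_power g[symmetric] power_Suc mult_ac)
  also have "Suc (?q - 1) = ?q" using q by simp
  also have "mfps_section ?q r (g * poly G f ^ ?q) = mfps_section ?q r g * poly G f"
    using mfps_section_power_card_mult[OF r, of "poly G f" g] by (simp add: mult.commute)
  finally show ?thesis by simp
qed


section \<open>The minimal annihilating polynomial\<close>

abbreviation mpolys :: "('a::comm_ring_1, 'n::finite) mfps set" where
  "mpolys \<equiv> mfps_polys UNIV"

section \<open>Exponents and weights of polynomials in \<open>y\<close>\<close>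

definition poly_support :: "('a::comm_ring_1, 'n::finite) mfps poly \<Rightarrow> (nat ^ 'n) set" where
  "poly_support A = (\<Union>j. mfps_support (Polynomial.coeff A j))"

lemma finite_poly_support:
  assumes "A \<in> polys_over mpolys"
  shows "finite (poly_support A)"
proof -
  have "poly_support A \<subseteq> (\<Union>j\<le>Polynomial.degree A. mfps_support (Polynomial.coeff A j))"
    by (auto simp: poly_support_def) (metis atMost_iff coeff_eq_0 empty_iff mfps_support_zero not_le)
  moreover have "finite \<dots>"
    using assms by (auto simp: polys_over_def mfps_polys_UNIV)
  ultimately show ?thesis by (rule finite_subset)
qed

lemma poly_support_empty_iff: "poly_support A = {} \<longleftrightarrow> A = 0"
  by (auto simp: poly_support_def poly_eq_iff)

lemma poly_support_mult:
  assumes "i \<in> poly_support (A * B)"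
  obtains u v where "u \<in> poly_support A" "v \<in> poly_support B" "i = u + v"
proof -
  obtain j where "mfps_nth (Polynomial.coeff (A * B) j) i \<noteq> 0"
    using assms by (auto simp: poly_support_def mfps_support_iff)
  then have "(\<Sum>k\<le>j. mfps_nth (Polynomial.coeff A k * Polynomial.coeff B (j - k)) i) \<noteq> 0"
    by (simp add: coeff_mult)
  then obtain k where "mfps_nth (Polynomial.coeff A k * Polynomial.coeff B (j - k)) i \<noteq> 0"
    by (rule sum.not_neutral_contains_not_neutral)
  then have "i \<in> mfps_support (Polynomial.coeff A k * Polynomial.coeff B (j - k))"
    by (simp add: mfps_support_iff)
  from subsetD[OF mfps_support_mult_subset this] obtain u v where
    "i = u + v" "u \<in> mfps_support (Polynomial.coeff A k)" "v \<in> mfps_support (Polynomial.coeff B (j - k))"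
    by auto
  then show ?thesis
    using that[of u v] by (auto simp: poly_support_def)
qed

definition mfps_homog :: "(nat ^ 'n \<Rightarrow> nat) \<Rightarrow> nat \<Rightarrow> ('a::comm_ring_1, 'n::finite) mfps \<Rightarrow> ('a, 'n) mfps" where
  "mfps_homog w m f = Abs_mfps (\<lambda>i. if w i = m then mfps_nth f i else 0)"

lemma mfps_nth_homog [simp]: "mfps_nth (mfps_homog w m f) i = (if w i = m then mfps_nth f i else 0)"
  by (simp add: mfps_homog_def)

lemma mfps_homog_0 [simp]: "mfps_homog w m 0 = 0"
  by (rule mfps_eqI) simp

lemma mfps_homog_sum: "mfps_homog w m (sum f A) = (\<Sum>x\<in>A. mfps_homog w m (f x))"
  by (rule mfps_eqI) simp

lemma mfps_homog_mult:
  assumes add: "\<And>i j. w (i + j) = w i + w j"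
    and f: "\<And>i. i \<in> mfps_support f \<Longrightarrow> w i \<le> a" and g: "\<And>i. i \<in> mfps_support g \<Longrightarrow> w i \<le> b"
  shows "mfps_homog w (a + b) (f * g) = mfps_homog w a f * mfps_homog w b g"
proof (rule mfps_eqI)
  fix k
  show "mfps_nth (mfps_homog w (a + b) (f * g)) k = mfps_nth (mfps_homog w a f * mfps_homog w b g) k"
  proof (cases "w k = a + b")
    case True
    have "mfps_nth f i * mfps_nth g j = mfps_nth (mfps_homog w a f) i * mfps_nth (mfps_homog w b g) j"
      if "i + j = k" for i j
    proof (cases "mfps_nth f i = 0 \<or> mfps_nth g j = 0")
      case False
      then have "w i \<le> a" "w j \<le> b" using f g by (auto simp: mfps_support_iff)
      moreover have "w i + w j = a + b" using that True add by metis
      ultimately show ?thesis by simp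
    qed auto
    then show ?thesis using True by (auto simp: mfps_nth_mult intro!: sum.cong)
  next
    case False
    then show ?thesis by (auto simp: mfps_nth_mult add intro!: sum.neutral)
  qed
qed

text \<open>The product of the parts of highest weight is the part of highest weight of the product.\<close>

lemma poly_support_mult_top:
  fixes A B :: "('a::idom, 'n::finite) mfps poly" and w :: "nat ^ 'n \<Rightarrow> nat"
  assumes add: "\<And>i j. w (i + j) = w i + w j"
    and A: "A \<in> polys_over mpolys" "A \<noteq> 0" and B: "B \<in> polys_over mpolys" "B \<noteq> 0"
  shows "\<exists>i\<in>poly_support (A * B). w i = Max (w ` poly_support A) + Max (w ` poly_support B)"
proof -
  \<comment> \<open>The cut is at the highest weight of the whole polynomial, not of each
    coefficient; this makes \<open>top\<close> multiplicative.\<close>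
  define top where "top = (\<lambda>A :: ('a, 'n) mfps poly. map_poly (mfps_homog w (Max (w ` poly_support A))) A)"
  have coeff_top: "Polynomial.coeff (top A) j = mfps_homog w (Max (w ` poly_support A)) (Polynomial.coeff A j)"
    for A :: "('a, 'n) mfps poly" and j
    by (simp add: top_def coeff_map_poly)
  have le: "w i \<le> Max (w ` poly_support A)"
    if "i \<in> mfps_support (Polynomial.coeff A j)" "A \<in> polys_over mpolys" for i j and A :: "('a, 'n) mfps poly"
    using that finite_poly_support[OF that(2)] by (intro Max_ge) (auto simp: poly_support_def)
  have nz: "top A \<noteq> 0" if "A \<in> polys_over mpolys" "A \<noteq> 0" for A :: "('a, 'n) mfps poly"
  proof -
    have "Max (w ` poly_support A) \<in> w ` poly_support A"
      using that finite_poly_support by (intro Max_in) (auto simp: poly_support_empty_iff)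
    then obtain i j where "w i = Max (w ` poly_support A)" "mfps_nth (Polynomial.coeff A j) i \<noteq> 0"
      by (auto simp: poly_support_def mfps_support_iff)
    then have "mfps_nth (Polynomial.coeff (top A) j) i \<noteq> 0"
      by (simp add: coeff_top)
    then show ?thesis by auto
  qed
  have "top A * top B \<noteq> 0" using nz A B by simp
  then obtain j where "Polynomial.coeff (top A * top B) j \<noteq> 0"
    using leading_coeff_neq_0 by blast
  moreover have "Polynomial.coeff (top A * top B) j =
    mfps_homog w (Max (w ` poly_support A) + Max (w ` poly_support B)) (Polynomial.coeff (A * B) j)"
    unfolding coeff_mult coeff_top mfps_homog_sum
    by (intro sum.cong refl mfps_homog_mult[symmetric] add le A B)
  ultimately obtain i where
    "mfps_nth (mfps_homog w (Max (w ` poly_support A) + Max (w ` poly_support B)) (Polynomial.coeff (A * B) j)) i \<noteq> 0"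
    by (metis mfps_eqI mfps_nth_zero)
  then show ?thesis
    by (intro bexI[of _ i]) (auto simp: poly_support_def mfps_support_iff split: if_splits)
qed

section \<open>Divisibility by a minimal annihilator\<close>

definition annihilators :: "('a::field, 'n::finite) mfps \<Rightarrow> ('a, 'n) mfps poly set" where
  "annihilators f = {A \<in> polys_over mpolys. A \<noteq> 0 \<and> poly A f = 0}"

text \<open>Pseudo-division gives \<open>[:c:] * A = E * s\<close>. Splitting \<open>c\<close>
  yields \<open>E = c1 * E'\<close> with \<open>c1\<close> free of \<open>y\<close> and
  \<open>E'\<close> dividing \<open>A\<close>. As \<open>E'\<close> annihilates \<open>f\<close>
  with the same degree in \<open>y\<close>, the minimal total degree of \<open>E\<close> forces
  \<open>c1\<close> to be a nonzero constant of the field. Minimality thus takes the place of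
  primitivity.\<close>

lemma exists_minimal_annihilator:
  fixes f :: "('a::field, 'n::finite) mfps"
  assumes "annihilators f \<noteq> {}"
  obtains E where "E \<in> annihilators f"
    and "\<And>A. A \<in> annihilators f \<Longrightarrow> Polynomial.degree E \<le> Polynomial.degree A"
    and "\<And>A. A \<in> annihilators f \<Longrightarrow> \<exists>B\<in>polys_over mpolys. A = E * B"
proof -
  interpret R: subdomain "mpolys :: ('a, 'n) mfps set"
    by (rule subdomain_mfps_polys)
  interpret P: subdomain "polys_over mpolys :: ('a, 'n) mfps poly set"
    by (rule R.subdomain_polys_over)
  obtain E0 where E0: "E0 \<in> annihilators f"
    "\<And>A. A \<in> annihilators f \<Longrightarrow> Polynomial.degree E0 \<le> Polynomial.degree A"
    using ex_has_least_nat[of "\<lambda>A. A \<in> annihilators f" _ Polynomial.degree] assms by blast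
  define tot where "tot = (\<lambda>i :: nat ^ 'n. \<Sum>k\<in>UNIV. i $ k)"
  have tot_add: "tot (i + j) = tot i + tot j" for i j
    by (simp add: tot_def sum.distrib)
  define W where "W = (\<lambda>A :: ('a, 'n) mfps poly. Max (tot ` poly_support A))"
  obtain E where E: "E \<in> annihilators f" "Polynomial.degree E = Polynomial.degree E0"
    and W_min: "\<And>A. A \<in> annihilators f \<Longrightarrow> Polynomial.degree A = Polynomial.degree E0 \<Longrightarrow> W E \<le> W A"
    using ex_has_least_nat[of "\<lambda>A. A \<in> annihilators f \<and> Polynomial.degree A = Polynomial.degree E0" E0 W] E0(1)
    by blast
  have E_props: "E \<in> polys_over mpolys" "E \<noteq> 0" "poly E f = 0"
    using E(1) by (auto simp: annihilators_def)
  have "\<exists>B\<in>polys_over mpolys. A = E * B" if A: "A \<in> annihilators f" for A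
  proof -
    have A_props: "A \<in> polys_over mpolys" "A \<noteq> 0" "poly A f = 0"
      using A by (auto simp: annihilators_def)
    obtain c s r where *: "c \<in> mpolys" "s \<in> polys_over mpolys" "r \<in> polys_over mpolys" "c \<noteq> 0"
      "[:c:] * A = E * s + r" "r = 0 \<or> Polynomial.degree r < Polynomial.degree E"
      using R.pseudo_division[OF E_props(1,2) A_props(1)] by blast
    have "poly r f = 0"
      using arg_cong[OF *(5), of "\<lambda>A. poly A f"] E_props A_props by simp
    then have "r = 0"
      using *(3,6) E0(2)[of r] E(2) by (force simp: annihilators_def)
    with *(5) have eq: "[:c:] * A = E * s" by simp
    have "\<exists>k. prime_product mpolys k c"
      using factorial_in_mfps_polys *(1,4) unfolding factorial_in_def by blast
    then obtain k where "prime_product (polys_over mpolys) k [:c:]"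
      using R.prime_product_const by blast
    from P.prime_product_split[OF this A_props(1) E_props(1) *(2) eq]
    obtain c1 c2 E' s' where sp: "c1 \<in> polys_over mpolys" "c2 \<in> polys_over mpolys"
      "E' \<in> polys_over mpolys" "s' \<in> polys_over mpolys"
      "[:c:] = c1 * c2" "E = c1 * E'" "s = c2 * s'" "A = E' * s'" by blast
    have c1_nz: "c1 \<noteq> 0" and E'_nz: "E' \<noteq> 0" using E_props sp by auto
    have "Polynomial.degree (c1 * c2) = 0" "c2 \<noteq> 0"
      using sp(5) *(4) by (metis degree_pCons_0, auto)
    then have deg_c1: "Polynomial.degree c1 = 0"
      using c1_nz by (simp add: degree_mult_eq)
    then obtain g where g: "c1 = [:g:]" by (rule degree_eq_zeroE)
    have g_nz: "g \<noteq> 0" using c1_nz g by simp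
    have "poly E' f = 0"
      using E_props(3) g_nz by (simp add: sp(6) g)
    moreover have "Polynomial.degree E' = Polynomial.degree E"
      using c1_nz E'_nz deg_c1 by (simp add: sp(6) degree_mult_eq)
    ultimately have "W E \<le> W E'"
      using W_min[of E'] E'_nz sp(3) E(2) by (simp add: annihilators_def)
    moreover obtain i where "i \<in> poly_support E" "tot i = W c1 + W E'"
      using poly_support_mult_top[of tot, OF tot_add sp(1) c1_nz sp(3) E'_nz] by (auto simp: W_def sp(6))
    moreover have "tot i \<le> W E" if "i \<in> poly_support E" for i
      unfolding W_def using that finite_poly_support[OF E_props(1)] by (intro Max_ge) auto
    ultimately have "W c1 = 0" by fastforce
    have "i = 0" if "i \<in> mfps_support g" for i
    proof -
      have "i \<in> poly_support c1"
        using that by (auto simp: poly_support_def g intro!: exI[of _ 0])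
      then have "tot i \<le> W c1"
        unfolding W_def using finite_poly_support[OF sp(1)] by (intro Max_ge) auto
      then show "i = 0"
        using \<open>W c1 = 0\<close> by (simp add: tot_def vec_eq_iff)
    qed
    then have g_eq: "g = mfps_term (mfps_nth g 0) 0"
      by (intro mfps_eqI) (auto simp: mfps_support_iff)
    then have "mfps_nth g 0 \<noteq> 0"
      using g_nz by (metis mfps_eqI mfps_nth_term mfps_nth_zero)
    define u where "u = mfps_term (inverse (mfps_nth g 0)) (0 :: nat ^ 'n)"
    have "g * u = 1"
      using \<open>mfps_nth g 0 \<noteq> 0\<close> by (subst g_eq) (simp add: u_def mfps_term_mult mfps_term_1)
    then have "c1 * [:u:] = 1" by (simp add: g one_pCons mult.commute)
    then have "A = E * ([:u:] * s')"
      unfolding sp(6,8) by (metis mult.assoc mult.commute mult.left_neutral)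
    moreover have "u \<in> mpolys"
      by (simp add: u_def mfps_polys_UNIV mfps_support_def)
    then have "[:u:] * s' \<in> polys_over mpolys"
      using sp(4) by (intro P.mult_closed R.const_polys_over)
    ultimately show ?thesis by blast
  qed
  with that[of E] E E0(2) show thesis by metis
qed

text \<open>Highest weights add under multiplication and are nonnegative, so a factor cannot exceed
  a bound for the product.\<close>

lemma poly_support_factor_le:
  fixes A B :: "('a::idom, 'n::finite) mfps poly" and w :: "nat ^ 'n \<Rightarrow> nat"
  assumes add: "\<And>i j. w (i + j) = w i + w j"
    and A: "A \<in> polys_over mpolys" and B: "B \<in> polys_over mpolys" and "A * B \<noteq> 0"
    and le: "\<And>i. i \<in> poly_support (A * B) \<Longrightarrow> w i \<le> m" and i: "i \<in> poly_support A"
  shows "w i \<le> m"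
proof -
  obtain j where "j \<in> poly_support (A * B)" "w j = Max (w ` poly_support A) + Max (w ` poly_support B)"
    using poly_support_mult_top[of w, OF add A _ B] assms(4) by auto
  moreover have "w i \<le> Max (w ` poly_support A)"
    using finite_poly_support[OF A] i by (intro Max_ge) auto
  ultimately show ?thesis using le[of j] by simp
qed

section \<open>Separability of a minimal annihilator\<close>

lemma mfps_section_mpolys:
  assumes "g \<in> mpolys" "q > 0"
  shows "mfps_section q r g \<in> mpolys"
proof -
  let ?\<phi> = "\<lambda>i. \<chi> k. q * i $ k + r $ k"
  have "inj ?\<phi>" using assms(2) by (auto simp: inj_on_def vec_eq_iff)
  moreover have "mfps_support (mfps_section q r g) = ?\<phi> -` mfps_support g"
    by (auto simp: mfps_support_def)
  ultimately show ?thesis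
    using assms(1) by (simp add: mfps_polys_UNIV finite_vimageI)
qed

lemma mfps_eq_0_if_sections:
  fixes g :: "('a::comm_ring_1, 'n::finite) mfps"
  assumes "\<And>r. r \<in> digit_vectors q \<Longrightarrow> mfps_section q r g = 0" "q > 0"
  shows "g = 0"
proof (rule mfps_eqI)
  fix v :: "nat ^ 'n"
  define r where "r = (\<chi> k. v $ k mod q)"
  have "r \<in> digit_vectors q" using assms(2) by (simp add: r_def digit_vectors_def)
  from assms(1)[OF this] have "mfps_nth (mfps_section q r g) (\<chi> k. v $ k div q) = 0" by simp
  then show "mfps_nth g v = mfps_nth 0 v"
    by (simp add: r_def)
qed

text \<open>Otherwise \<open>pderiv E = 0\<close> by minimality, so \<open>E\<close> is a polynomial
  in \<open>y ^ p\<close>. Sections extract \<open>q\<close>-th powers, hence the relation for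
  \<open>f\<close> is first raised to the power \<open>p ^ e\<close>, where
  \<open>q = p ^ e * p\<close>. Each section is then a relation of degree at most
  \<open>degree E div p\<close>, whose coefficients must vanish by minimality. With all sections of
  its power zero, the leading coefficient of \<open>E\<close> would be 0.\<close>

lemma pderiv_minimal_annihilator:
  fixes f :: "('a::{field, finite}, 'n::finite) mfps"
  assumes E: "E \<in> annihilators f"
    and min: "\<And>A. A \<in> annihilators f \<Longrightarrow> Polynomial.degree E \<le> Polynomial.degree A"
  shows "poly (pderiv E) f \<noteq> 0"
proof
  assume zero: "poly (pderiv E) f = 0"
  interpret R: subdomain "mpolys :: ('a, 'n) mfps set"
    by (rule subdomain_mfps_polys)
  have E_props: "E \<in> polys_over mpolys" "E \<noteq> 0" "poly E f = 0"
    using E by (auto simp: annihilators_def)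
  have deg: "Polynomial.degree E > 0"
  proof (rule ccontr)
    assume "\<not> ?thesis"
    then obtain c where "E = [:c:]" by (metis degree_eq_zeroE not_gr_zero)
    then show False using E_props by simp
  qed
  have of_nat_closed: "of_nat m \<in> (mpolys :: ('a, 'n) mfps set)" for m
    by (simp add: of_nat_mfps mfps_polys_UNIV mfps_support_def)
  have "pderiv E \<in> polys_over mpolys"
    using E_props(1) by (auto simp: polys_over_def coeff_pderiv simp del: of_nat_Suc intro!: R.mult_closed of_nat_closed)
  moreover have "Polynomial.degree (pderiv E) < Polynomial.degree E"
  proof -
    have "Polynomial.degree (pderiv E) \<le> Polynomial.degree E - 1"
      using deg by (intro degree_le) (auto simp: coeff_pderiv coeff_eq_0)
    then show ?thesis using deg by linarith
  qed
  ultimately have pd: "pderiv E = 0"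
    using min[of "pderiv E"] zero by (force simp: annihilators_def)
  obtain e where e: "CARD('a) = CHAR('a) ^ Suc e" "prime CHAR('a)"
    by (rule card_eq_CHAR_power)
  define p where "p = CHAR('a)"
  have p: "p > 1" "prime p" using e(2) prime_gt_1_nat by (auto simp: p_def)
  have q: "CARD('a) = p ^ e * p" "CARD('a) > 0"
    by (simp add: e(1) p_def mult.commute, simp add: card_gt_0_iff)
  have coeff_not_dvd: "Polynomial.coeff E j = 0" if j: "\<not> p dvd j" for j
  proof -
    obtain j' where j': "j = Suc j'" using j by (cases j) auto
    have "of_nat j * Polynomial.coeff E j = 0"
      using arg_cong[OF pd, of "\<lambda>A. Polynomial.coeff A j'"] by (simp add: coeff_pderiv j')
    moreover have "of_nat j \<noteq> (0 :: ('a, 'n) mfps)"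
      using j by (simp add: of_nat_eq_0_iff_char_dvd p_def)
    ultimately show ?thesis by simp
  qed
  define D where "D = Polynomial.degree E div p"
  define b where "b = (\<lambda>j. Polynomial.coeff E (p * j) ^ p ^ e)"
  have sum_b: "(\<Sum>j\<le>D. b j * (f ^ j) ^ CARD('a)) = 0"
  proof -
    have "(\<Sum>j\<le>D. b j * (f ^ j) ^ CARD('a)) = (\<Sum>j\<le>D. (Polynomial.coeff E (p * j) * f ^ (p * j)) ^ p ^ e)"
      by (intro sum.cong refl)
        (simp add: b_def q power_mult_distrib flip: power_mult, simp add: mult_ac)
    also have "\<dots> = (\<Sum>j\<le>D. Polynomial.coeff E (p * j) * f ^ (p * j)) ^ p ^ e"
      by (rule freshmans_dream_sum'[symmetric]) (use e(2) in \<open>simp_all add: p_def\<close>)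
    also have "(\<Sum>j\<le>D. Polynomial.coeff E (p * j) * f ^ (p * j)) =
      (\<Sum>i\<in>(\<lambda>j. p * j) ` {..D}. Polynomial.coeff E i * f ^ i)"
      using p by (subst sum.reindex) (auto simp: inj_on_def)
    also have "\<dots> = (\<Sum>i\<le>Polynomial.degree E. Polynomial.coeff E i * f ^ i)"
    proof (rule sum.mono_neutral_left)
      show "(\<lambda>j. p * j) ` {..D} \<subseteq> {..Polynomial.degree E}"
        using p by (auto simp: D_def less_eq_div_iff_mult_less_eq mult.commute)
      show "\<forall>i\<in>{..Polynomial.degree E} - (\<lambda>j. p * j) ` {..D}. Polynomial.coeff E i * f ^ i = 0"
      proof
        fix i assume i: "i \<in> {..Polynomial.degree E} - (\<lambda>j. p * j) ` {..D}"
        have "\<not> p dvd i"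
        proof
          assume "p dvd i"
          then obtain j where j: "i = p * j" by (auto simp: dvd_def)
          then have "j \<le> D"
            using i p by (auto simp: D_def less_eq_div_iff_mult_less_eq mult.commute)
          then show False using i j by auto
        qed
        then show "Polynomial.coeff E i * f ^ i = 0" by (simp add: coeff_not_dvd)
      qed
    qed auto
    also have "\<dots> = 0" using E_props(3) by (simp add: poly_altdef)
    finally show ?thesis using p by simp
  qed
  have "D < Polynomial.degree E" using p deg by (simp add: D_def)
  have section_0: "mfps_section CARD('a) r (b j) = 0" if r: "r \<in> digit_vectors CARD('a)" and "j \<le> D" for r j
  proof -
    define F where "F = (\<Sum>j\<le>D. Polynomial.monom (mfps_section CARD('a) r (b j)) j)"
    have coeff_F: "Polynomial.coeff F i = (if i \<le> D then mfps_section CARD('a) r (b i) else 0)" for i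
      by (simp add: F_def coeff_sum sum.delta)
    have "F \<in> polys_over mpolys"
      using q(2) E_props(1) R.zero_closed
      by (auto simp: polys_over_def coeff_F b_def intro!: mfps_section_mpolys R.power_closed)
    moreover have "poly F f = 0"
    proof -
      have "poly F f = (\<Sum>j\<le>D. mfps_section CARD('a) r ((f ^ j) ^ CARD('a) * b j))"
        unfolding mfps_section_power_card_mult[OF r]
        by (simp add: F_def poly_sum poly_monom mult.commute)
      also have "\<dots> = mfps_section CARD('a) r (\<Sum>j\<le>D. b j * (f ^ j) ^ CARD('a))"
        by (simp add: mfps_section_sum mult.commute)
      finally show ?thesis by (simp add: sum_b)
    qed
    moreover have "Polynomial.degree F \<le> D"
      by (rule degree_le) (simp add: coeff_F)
    ultimately have "F = 0"
      using min[of F] \<open>D < Polynomial.degree E\<close> by (auto simp: annihilators_def)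
    then have "Polynomial.coeff F j = 0" by simp
    then show ?thesis using coeff_F[of j] \<open>j \<le> D\<close> by (simp only: if_True)
  qed
  have "b D = 0"
    by (rule mfps_eq_0_if_sections[OF _ q(2)]) (rule section_0[OF _ order_refl])
  have "p dvd Polynomial.degree E"
    using coeff_not_dvd[of "Polynomial.degree E"] E_props(2) by auto
  then have "p * D = Polynomial.degree E" by (simp add: D_def)
  with \<open>b D = 0\<close> have "Polynomial.coeff E (Polynomial.degree E) ^ p ^ e = 0"
    by (simp only: b_def)
  then show False using E_props(2) by simp
qed


section \<open>Counting and automata\<close>

lemma poly_support_power_le:
  fixes w :: "nat ^ 'n::finite \<Rightarrow> nat"
  assumes add: "\<And>i j. w (i + j) = w i + w j"
    and le: "\<And>i. i \<in> poly_support E \<Longrightarrow> w i \<le> m"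
  shows "i \<in> poly_support (E ^ k) \<Longrightarrow> w i \<le> k * m"
proof (induction k arbitrary: i)
  case 0
  have "w 0 = 0" using add[of 0 0] by simp
  then show ?case
    using 0 by (auto simp: poly_support_def mfps_support_iff coeff_1 mfps_nth_one of_bool_def split: if_splits)
next
  case (Suc k)
  then obtain u v where "u \<in> poly_support E" "v \<in> poly_support (E ^ k)" "i = u + v"
    by (auto elim: poly_support_mult)
  then show ?case using Suc.IH[of v] le[of u] by (simp add: add)
qed

text \<open>\<open>P * E ^ (q - 1)\<close> has weight at most \<open>q * m\<close>, and a section
  divides exponents by \<open>q\<close>, rounding down. The additive weight is left open because the
  single coordinates and their sum are both needed.\<close>

lemma poly_support_section_le:
  fixes w :: "nat ^ 'n::finite \<Rightarrow> nat"
  assumes add: "\<And>i j. w (i + j) = w i + w j" and q: "q > 0"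
    and E: "\<And>i. i \<in> poly_support E \<Longrightarrow> w i \<le> m"
    and P: "\<And>i. i \<in> poly_support P \<Longrightarrow> w i \<le> m"
    and i: "i \<in> poly_support (poly_section q r (P * E ^ (q - 1)))"
  shows "w i \<le> m"
proof -
  have scale: "w (\<chi> k. c * v $ k) = c * w v" for c v
  proof (induction c)
    case 0
    have "(\<chi> k. 0 * v $ k) = 0" by (simp add: vec_eq_iff)
    then show ?case using add[of 0 0] by simp
  next
    case (Suc c)
    have "(\<chi> k. Suc c * v $ k) = v + (\<chi> k. c * v $ k)" by (simp add: vec_eq_iff)
    then show ?case using Suc add by simp
  qed
  have "(\<chi> k. q * i $ k + r $ k) \<in> poly_support (P * E ^ (q - 1))"
    using i q by (auto simp: poly_support_def mfps_support_iff coeff_poly_section)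
  then obtain u v where uv: "u \<in> poly_support P" "v \<in> poly_support (E ^ (q - 1))"
    "(\<chi> k. q * i $ k + r $ k) = u + v"
    by (elim poly_support_mult)
  have "q * w i \<le> w (\<chi> k. q * i $ k) + w r" by (simp add: scale)
  also have "\<dots> = w ((\<chi> k. q * i $ k) + r)" by (simp add: add)
  also have "(\<chi> k. q * i $ k) + r = u + v" unfolding uv(3)[symmetric] by (simp add: vec_eq_iff)
  also have "w (u + v) \<le> m + (q - 1) * m"
    using P[OF uv(1)] poly_support_power_le[of w, OF add E uv(2)] by (simp add: add add_mono)
  also have "\<dots> = q * m" using q by (cases q) auto
  finally show ?thesis using q by simp
qed

section \<open>Counting polynomials and exponents\<close>

definition bounded_polys :: "nat \<Rightarrow> (nat ^ 'n) set \<Rightarrow> ('a::comm_ring_1, 'n::finite) mfps poly set" where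
  "bounded_polys m Q = {P. (\<forall>j\<ge>m. Polynomial.coeff P j = 0) \<and> poly_support P \<subseteq> Q}"

lemma card_bounded_polys:
  assumes "finite Q"
  shows "finite (bounded_polys m Q :: ('a::{field, finite}, 'n::finite) mfps poly set)"
    and "card (bounded_polys m Q :: ('a, 'n) mfps poly set) \<le> CARD('a) ^ (m * card Q)"
proof -
  define \<phi> where "\<phi> = (\<lambda>P :: ('a, 'n) mfps poly. \<lambda>(j, i)\<in>{..<m} \<times> Q. mfps_nth (Polynomial.coeff P j) i)"
  have inj: "inj_on \<phi> (bounded_polys m Q)"
  proof (rule inj_onI)
    fix P R :: "('a, 'n) mfps poly"
    assume P: "P \<in> bounded_polys m Q" and R: "R \<in> bounded_polys m Q" and eq: "\<phi> P = \<phi> R"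
    have "mfps_nth (Polynomial.coeff P j) i = mfps_nth (Polynomial.coeff R j) i" for i j
    proof (cases "j < m \<and> i \<in> Q")
      case True
      then show ?thesis using fun_cong[OF eq, of "(j, i)"] by (simp add: \<phi>_def)
    next
      case False
      have "mfps_nth (Polynomial.coeff S j) i = 0" if S: "S \<in> bounded_polys m Q" for S :: "('a, 'n) mfps poly"
      proof (cases "j < m")
        case True
        with False have "i \<notin> poly_support S" using S by (auto simp: bounded_polys_def)
        then show ?thesis by (auto simp: poly_support_def mfps_support_iff)
      qed (use S in \<open>simp add: bounded_polys_def\<close>)
      then show ?thesis using P R by simp
    qed
    then show "P = R" by (auto simp: poly_eq_iff intro: mfps_eqI)
  qed
  have sub: "\<phi> ` bounded_polys m Q \<subseteq> ({..<m} \<times> Q) \<rightarrow>\<^sub>E UNIV"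
    by (auto simp: \<phi>_def split: if_splits)
  have fin: "finite (({..<m} \<times> Q) \<rightarrow>\<^sub>E (UNIV :: 'a set))"
    using assms by (intro finite_PiE) auto
  show "finite (bounded_polys m Q :: ('a, 'n) mfps poly set)"
    using finite_subset[OF sub fin] inj by (rule finite_imageD)
  have "card (bounded_polys m Q :: ('a, 'n) mfps poly set) \<le> card (({..<m} \<times> Q) \<rightarrow>\<^sub>E (UNIV :: 'a set))"
    by (rule card_inj_on_le[OF inj sub fin])
  also have "\<dots> = CARD('a) ^ (m * card Q)"
    using assms by (simp add: card_PiE card_cartesian_product)
  finally show "card (bounded_polys m Q :: ('a, 'n) mfps poly set) \<le> CARD('a) ^ (m * card Q)" .
qed

text \<open>The intersection of a box and a simplex, which is where the minimum in \<open>N\<close>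
  and \<open>N'\<close> comes from.\<close>

definition exponent_region :: "('n::finite \<Rightarrow> nat) \<Rightarrow> nat \<Rightarrow> (nat ^ 'n) set" where
  "exponent_region ht h = {i. (\<forall>k. i $ k \<le> ht k) \<and> (\<Sum>k\<in>UNIV. i $ k) \<le> h}"

lemma card_exponent_region:
  fixes ht :: "'n::finite \<Rightarrow> nat"
  shows "finite (exponent_region ht h)"
    and "card (exponent_region ht h) \<le> min (\<Prod>k\<in>UNIV. ht k + 1) ((CARD('n) + h) choose CARD('n))"
proof -
  have inj: "inj_on ($) (exponent_region ht h)" by (auto simp: inj_on_def vec_eq_iff)
  have sub: "($) ` exponent_region ht h \<subseteq> (\<Pi>\<^sub>E k\<in>UNIV. {..ht k})"
    by (auto simp: exponent_region_def)
  have fin: "finite (\<Pi>\<^sub>E k\<in>UNIV. {..ht k})" by (intro finite_PiE) auto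
  show "finite (exponent_region ht h)"
    using finite_subset[OF sub fin] inj by (rule finite_imageD)
  have "card (exponent_region ht h) \<le> card (\<Pi>\<^sub>E k\<in>UNIV. {..ht k})"
    by (rule card_inj_on_le[OF inj sub fin])
  then have 1: "card (exponent_region ht h) \<le> (\<Prod>k\<in>UNIV. ht k + 1)"
    by (simp add: card_PiE)
  obtain xs :: "'n list" where xs: "set xs = UNIV" "distinct xs"
    using finite_distinct_list[OF finite_class.finite_UNIV] by blast
  \<comment> \<open>a slack entry turns the bound \<open>h\<close> on the sum of the entries into an equality\<close>
  define \<phi> where "\<phi> = (\<lambda>i :: nat ^ 'n. (h - (\<Sum>k\<in>UNIV. i $ k)) # map (($) i) xs)"
  define L where "L = {l :: nat list. length l = CARD('n) + 1 \<and> sum_list l = h}"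
  have "length xs = CARD('n)" using distinct_card[OF xs(2)] xs(1) by simp
  moreover have "sum_list (map (($) i) xs) = (\<Sum>k\<in>UNIV. i $ k)" for i :: "nat ^ 'n"
    using sum_list_distinct_conv_sum_set[OF xs(2)] xs(1) by simp
  ultimately have subL: "\<phi> ` exponent_region ht h \<subseteq> L"
    by (auto simp: \<phi>_def L_def exponent_region_def)
  have injL: "inj_on \<phi> (exponent_region ht h)"
    using xs(1) by (auto simp: inj_on_def \<phi>_def vec_eq_iff)
  have "finite L"
    by (rule finite_subset[OF _ finite_lists_length_eq[of "{..h}" "CARD('n) + 1"]])
      (auto simp: L_def member_le_sum_list)
  then have "card (exponent_region ht h) \<le> card L"
    by (rule card_inj_on_le[OF injL subL])
  also have "card L = (CARD('n) + h) choose h"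
    unfolding L_def by (subst card_length_sum_list) (simp add: add.commute)
  also have "\<dots> = (CARD('n) + h) choose CARD('n)"
    by (subst binomial_symmetric) auto
  finally show "card (exponent_region ht h) \<le> min (\<Prod>k\<in>UNIV. ht k + 1) ((CARD('n) + h) choose CARD('n))"
    using 1 by simp
qed

text \<open>The automata below run on series and on functionals, while a \<open>dfao\<close> has
  natural numbers as states; a bijection transports them.\<close>

lemma dfao_of_finite_set:
  fixes tr :: "'s \<Rightarrow> 'l \<Rightarrow> 's" and out :: "'s \<Rightarrow> 'o"
  assumes "finite A" "x0 \<in> A" and closed: "\<And>x l. x \<in> A \<Longrightarrow> l \<in> S \<Longrightarrow> tr x l \<in> A"
  obtains M where "is_dfao S M" "card (states M) = card A"
    "\<And>w. set w \<subseteq> S \<Longrightarrow> dfao_output M w = out (foldl tr x0 w)"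
proof -
  obtain enc :: "'s \<Rightarrow> nat" where enc: "bij_betw enc A {0..<card A}"
    using ex_bij_betw_finite_nat[OF assms(1)] by blast
  define dec where "dec = the_inv_into A enc"
  have inv: "dec (enc x) = x" if "x \<in> A" for x
    using that bij_betw_imp_inj_on[OF enc] by (simp add: dec_def the_inv_into_f_f)
  define M where "M = \<lparr>states = enc ` A, init = enc x0,
    next_state = (\<lambda>s l. enc (tr (dec s) l)), out = (\<lambda>s. out (dec s))\<rparr>"
  have run: "foldl (next_state M) (init M) w = enc (foldl tr x0 w) \<and> foldl tr x0 w \<in> A"
    if "set w \<subseteq> S" for w
    using that
    by (induction w rule: rev_induct) (auto simp: M_def inv assms(2) closed)
  show thesis
  proof
    show "is_dfao S M"
      using assms by (auto simp: is_dfao_def M_def inv)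
    show "card (states M) = card A"
      using bij_betw_imp_inj_on[OF enc] by (simp add: M_def card_image)
    show "dfao_output M w = out (foldl tr x0 w)" if "set w \<subseteq> S" for w
      using run[OF that] by (simp add: dfao_output_def inv) (simp add: M_def inv)
  qed
qed

section \<open>Reverse reading with series as states\<close>

lemma set_lsd_expansion: "q > 0 \<Longrightarrow> set (lsd_expansion q L i) \<subseteq> digit_vectors q"
  by (auto simp: lsd_expansion_def digit_vectors_def)

text \<open>Successive sections compose to a section of modulus \<open>q ^ L\<close>, whose
  remainder is assembled from the digits, least significant first.\<close>

lemma foldl_section_lsd_expansion:
  "mfps_nth (foldl (\<lambda>g r. mfps_section q r g) f (lsd_expansion q L i)) v =
     mfps_nth f (\<chi> k. q ^ L * v $ k + i $ k mod q ^ L)"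
proof (induction L arbitrary: v)
  case 0
  then show ?case by (simp add: lsd_expansion_def)
next
  case (Suc L)
  have "q ^ L * (q * v $ k + (i $ k div q ^ L) mod q) + i $ k mod q ^ L =
    q ^ Suc L * v $ k + i $ k mod q ^ Suc L" for k
    using mod_mult2_eq[of "i $ k" "q ^ L" q] by (simp add: algebra_simps)
  then show ?case
    using Suc by (simp add: lsd_expansion_def)
qed

lemma foldl_section_lsd_expansion_0:
  fixes f :: "('a::comm_ring_1, 'n::finite) mfps" and i :: "nat ^ 'n"
  assumes "\<forall>k. i $ k < q ^ L"
  shows "mfps_nth (foldl (\<lambda>g r. mfps_section q r g) f (lsd_expansion q L i)) 0 = mfps_nth f i"
proof -
  have "(\<chi> k. q ^ L * (0 :: nat ^ 'n) $ k + i $ k mod q ^ L) = i"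
    using assms by (simp add: vec_eq_iff)
  then show ?thesis by (simp add: foldl_section_lsd_expansion)
qed

text \<open>Reading the least significant digit \<open>r\<close> replaces the sequence by its
  section at \<open>r\<close>. After all digits the wanted entry is the constant coefficient, and
  padding zeros keep it there.\<close>

lemma comp_reverse_le:
  fixes f :: "('a::comm_ring_1, 'n::finite) mfps"
  assumes "q > 0" "finite A" "f \<in> A"
    and "\<And>g r. g \<in> A \<Longrightarrow> r \<in> digit_vectors q \<Longrightarrow> mfps_section q r g \<in> A"
  shows "comp_reverse q (mfps_nth f) \<le> enat (card A)"
proof -
  obtain M where M: "is_dfao (digit_vectors q) M" "card (states M) = card A"
    "\<And>w. set w \<subseteq> digit_vectors q \<Longrightarrow>
      dfao_output M w = mfps_nth (foldl (\<lambda>g r. mfps_section q r g) f w) 0"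
    using dfao_of_finite_set[of A f "digit_vectors q" "\<lambda>g r. mfps_section q r g" "\<lambda>g. mfps_nth g 0"]
      assms(2-4) by blast
  have "generates_reverse q M (mfps_nth f)"
    unfolding generates_reverse_def
    by (simp add: M(3)[OF set_lsd_expansion[OF assms(1)]] foldl_section_lsd_expansion_0)
  then show ?thesis
    unfolding comp_reverse_def using M(1,2) by (intro INF_lower2[of M]) auto
qed

section \<open>Direct reading with functionals as states\<close>

definition linear_functionals :: "('a::comm_ring_1, 'n::finite) mfps set \<Rightarrow> (('a, 'n) mfps \<Rightarrow> 'a) set" where
  "linear_functionals W = {\<phi> \<in> W \<rightarrow>\<^sub>E UNIV. (\<forall>x\<in>W. \<forall>y\<in>W. \<phi> (x + y) = \<phi> x + \<phi> y) \<and>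
     (\<forall>c. \<forall>x\<in>W. \<phi> (mfps_term c 0 * x) = c * \<phi> x)}"

text \<open>A functional is determined by its values on a basis \<open>B\<close> of
  \<open>W\<close>, and families of scalars on \<open>B\<close> embed into \<open>W\<close> as
  linear combinations. So passing to the dual space costs no states.\<close>

lemma card_linear_functionals_le:
  fixes W :: "('a::{field, finite}, 'n::finite) mfps set"
  assumes fin: "finite W" and zero: "0 \<in> W"
    and add: "\<And>x y. x \<in> W \<Longrightarrow> y \<in> W \<Longrightarrow> x + y \<in> W"
    and scale: "\<And>c x. x \<in> W \<Longrightarrow> mfps_term c 0 * x \<in> W"
  shows "finite (linear_functionals W)" "card (linear_functionals W) \<le> card W"
proof -
  let ?s = "\<lambda>c g. mfps_term c (0 :: nat ^ 'n) * g"
  interpret vs: vector_space ?s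
  proof -
    show "vector_space ?s"
      by unfold_locales
        (simp_all add: mfps_term_add distrib_left distrib_right mult.assoc[symmetric] mfps_term_mult mfps_term_1)
  qed
  obtain B where B: "B \<subseteq> W" "vs.independent B" "W \<subseteq> vs.span B"
    using vs.basis_exists by metis
  have finB: "finite B" using B(1) fin by (rule finite_subset)
  have sum_W: "(\<Sum>b\<in>C. ?s (u b) b) \<in> W" if "C \<subseteq> B" for u C
  proof -
    have "finite C" using that finB by (rule finite_subset)
    then show ?thesis
      using that B(1) by (induction C rule: finite_induct) (auto intro: zero add scale)
  qed
  have \<phi>_sum: "\<phi> (\<Sum>b\<in>C. ?s (u b) b) = (\<Sum>b\<in>C. u b * \<phi> b)"
    if \<phi>: "\<phi> \<in> linear_functionals W" and "C \<subseteq> B" for \<phi> u C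
  proof -
    have zero': "\<phi> 0 = 0"
      using \<phi> zero add_cancel_right_left[of "\<phi> 0" "\<phi> 0"] by (force simp: linear_functionals_def)
    have "finite C" using that(2) finB by (rule finite_subset)
    then show ?thesis
      using that(2)
    proof (induction C rule: finite_induct)
      case empty
      then show ?case by (simp add: zero')
    next
      case (insert b C)
      have "b \<in> W" "?s (u b) b \<in> W" "(\<Sum>b\<in>C. ?s (u b) b) \<in> W"
        using insert.prems B(1) by (auto intro: scale sum_W)
      then have "\<phi> (?s (u b) b + (\<Sum>b\<in>C. ?s (u b) b)) = u b * \<phi> b + \<phi> (\<Sum>b\<in>C. ?s (u b) b)"
        using \<phi> by (simp add: linear_functionals_def)
      then show ?case using insert by simp
    qed
  qed
  let ?F = "B \<rightarrow>\<^sub>E (UNIV :: 'a set)"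
  have finF: "finite ?F" using finB by (intro finite_PiE) auto
  have inj1: "inj_on (\<lambda>\<phi>. restrict \<phi> B) (linear_functionals W)"
  proof (rule inj_onI)
    fix \<phi> \<psi> assume \<phi>: "\<phi> \<in> linear_functionals W" and \<psi>: "\<psi> \<in> linear_functionals W"
      and eq: "restrict \<phi> B = restrict \<psi> B"
    have eqB: "\<phi> b = \<psi> b" if "b \<in> B" for b using fun_cong[OF eq, of b] that by simp
    have "\<phi> x = \<psi> x" if "x \<in> W" for x
    proof -
      have "x \<in> vs.span B" using B(3) that by blast
      then obtain u where "x = (\<Sum>b\<in>B. ?s (u b) b)"
        by (auto simp: vs.span_finite[OF finB])
      then show ?thesis
        using \<phi>_sum[OF \<phi>, of B u] \<phi>_sum[OF \<psi>, of B u] eqB by simp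
    qed
    moreover have "\<phi> \<in> extensional W" "\<psi> \<in> extensional W"
      using \<phi> \<psi> by (auto simp: linear_functionals_def PiE_def)
    ultimately show "\<phi> = \<psi>" by (intro extensionalityI) auto
  qed
  have sub1: "(\<lambda>\<phi>. restrict \<phi> B) ` linear_functionals W \<subseteq> ?F" by auto
  show "finite (linear_functionals W)"
    using finite_subset[OF sub1 finF] inj1 by (rule finite_imageD)
  have inj2: "inj_on (\<lambda>u. \<Sum>b\<in>B. ?s (u b) b) ?F"
  proof (rule inj_onI)
    fix u v assume u: "u \<in> ?F" and v: "v \<in> ?F" and eq: "(\<Sum>b\<in>B. ?s (u b) b) = (\<Sum>b\<in>B. ?s (v b) b)"
    have "(\<Sum>b\<in>B. ?s (u b - v b) b) = 0"
      using eq by (simp add: vs.scale_left_diff_distrib sum_subtractf)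
    then have "u b - v b = 0" if "b \<in> B" for b
      using vs.independentD[OF B(2) finB subset_refl, of "\<lambda>b. u b - v b"] that by simp
    then show "u = v" using u v by (intro PiE_ext) auto
  qed
  have "card (linear_functionals W) \<le> card ?F" by (rule card_inj_on_le[OF inj1 sub1 finF])
  also have "\<dots> \<le> card W" by (rule card_inj_on_le[OF inj2 _ fin]) (auto intro: sum_W)
  finally show "card (linear_functionals W) \<le> card W" .
qed

text \<open>Reading from the most significant digit, the automaton has to apply the last section first;
  so its states are the compositions of the constant coefficient functional with sections.\<close>

lemma comp_direct_le:
  fixes f :: "('a::{field, finite}, 'n::finite) mfps"
  assumes q: "q > 0" and fin: "finite W" and f: "f \<in> W" and zero: "0 \<in> W"
    and add: "\<And>x y. x \<in> W \<Longrightarrow> y \<in> W \<Longrightarrow> x + y \<in> W"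
    and scale: "\<And>c x. x \<in> W \<Longrightarrow> mfps_term c 0 * x \<in> W"
    and section_closed: "\<And>g r. g \<in> W \<Longrightarrow> r \<in> digit_vectors q \<Longrightarrow> mfps_section q r g \<in> W"
  shows "comp_direct q (mfps_nth f) \<le> enat (card W)"
proof -
  define \<delta> where "\<delta> = (\<lambda>(\<phi> :: ('a, 'n) mfps \<Rightarrow> 'a) r. \<lambda>g\<in>W. \<phi> (mfps_section q r g))"
  define \<phi>0 where "\<phi>0 = (\<lambda>g\<in>W. mfps_nth g 0)"
  have section_scale: "mfps_section q r (mfps_term c 0 * g) = mfps_term c 0 * mfps_section q r g"
    for c r and g :: "('a, 'n) mfps"
    by (rule mfps_eqI) (simp add: mfps_nth_term_mult)
  have start: "\<phi>0 \<in> linear_functionals W"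
    by (auto simp: \<phi>0_def linear_functionals_def add scale mfps_nth_term_mult)
  have step: "\<delta> \<phi> r \<in> linear_functionals W"
    if "\<phi> \<in> linear_functionals W" "r \<in> digit_vectors q" for \<phi> r
    using that(1) section_closed[OF _ that(2)]
    by (auto simp: \<delta>_def linear_functionals_def add scale mfps_section_add section_scale)
  obtain M where M: "is_dfao (digit_vectors q) M" "card (states M) = card (linear_functionals W)"
    "\<And>w. set w \<subseteq> digit_vectors q \<Longrightarrow> dfao_output M w = foldl \<delta> \<phi>0 w f"
    using dfao_of_finite_set[of "linear_functionals W" \<phi>0 "digit_vectors q" \<delta> "\<lambda>\<phi>. \<phi> f"]
      card_linear_functionals_le(1)[OF fin zero add scale] start step by blast
  have run: "foldl \<delta> \<phi>0 (rev w) g = mfps_nth (foldl (\<lambda>g r. mfps_section q r g) g w) 0"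
    if "set w \<subseteq> digit_vectors q" "g \<in> W" for w g
    using that
  proof (induction w arbitrary: g)
    case Nil
    then show ?case by (simp add: \<phi>0_def)
  next
    case (Cons r w)
    then show ?case using section_closed by (simp add: \<delta>_def)
  qed
  have "dfao_output M (rev (lsd_expansion q L i)) = mfps_nth f i" if "\<forall>k. i $ k < q ^ L" for i L
  proof -
    have "set (rev (lsd_expansion q L i)) \<subseteq> digit_vectors q"
      using set_lsd_expansion[OF q] by simp
    from M(3)[OF this] show ?thesis
      by (simp only: run[OF set_lsd_expansion[OF q] f] foldl_section_lsd_expansion_0[OF that])
  qed
  then have "generates_direct q M (mfps_nth f)"
    by (simp add: generates_direct_def)
  then have "comp_direct q (mfps_nth f) \<le> enat (card (linear_functionals W))"
    unfolding comp_direct_def using M(1,2) by (intro INF_lower2[of M]) auto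
  also have "\<dots> \<le> enat (card W)"
    using card_linear_functionals_le(2)[OF fin zero add scale] by simp
  finally show ?thesis .
qed


section \<open>Degree, heights and residues\<close>

lemma mfps_nth_of_mpoly [simp]: "mfps_nth (mfps_of_mpoly p) i = Poly_Mapping.lookup p i"
  by (simp add: mfps_of_mpoly_def)

lemma mfps_support_of_mpoly: "mfps_support (mfps_of_mpoly p) = Poly_Mapping.keys p"
  by (auto simp: mfps_support_def in_keys_iff)

lemma mfps_of_mpoly_0 [simp]: "mfps_of_mpoly 0 = 0"
  by (rule mfps_eqI) simp

lemma mfps_of_mpoly_eq_0_iff: "mfps_of_mpoly p = 0 \<longleftrightarrow> p = 0"
  by (metis mfps_support_empty_iff mfps_support_of_mpoly keys_eq_empty)

lemma mfps_of_mpoly_mpolys: "mfps_of_mpoly p \<in> mpolys"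
  by (simp add: mfps_polys_UNIV mfps_support_of_mpoly)

lemma mpolys_of_mpoly:
  assumes "g \<in> mpolys"
  obtains p where "mfps_of_mpoly p = g"
proof
  have "finite {i. mfps_nth g i \<noteq> 0}"
    using assms by (simp add: mfps_polys_UNIV mfps_support_def)
  then show "mfps_of_mpoly (Abs_poly_mapping (mfps_nth g)) = g"
    by (intro mfps_eqI) simp
qed

lemma polys_over_mpolys_of_mpoly:
  fixes A :: "('a::idom, 'n::finite) mfps poly"
  assumes "A \<in> polys_over mpolys"
  obtains A' where "map_poly mfps_of_mpoly A' = A"
proof
  define lift :: "('a, 'n) mfps \<Rightarrow> nat ^ 'n \<Rightarrow>\<^sub>0 'a" where "lift = (\<lambda>g. SOME p. mfps_of_mpoly p = g)"
  have lift: "mfps_of_mpoly (lift g) = g" if "g \<in> mpolys" for g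
    unfolding lift_def by (rule someI_ex) (use mpolys_of_mpoly[OF that] in blast)
  \<comment> \<open>\<open>map_poly\<close> acts coefficientwise only for maps that fix 0.\<close>
  have "lift 0 = 0"
    using lift[of 0] by (simp add: mfps_of_mpoly_eq_0_iff mfps_polys_UNIV)
  then show "map_poly mfps_of_mpoly (map_poly lift A) = A"
    using assms by (simp add: poly_eq_iff coeff_map_poly lift polys_over_coeff)
qed

lemma annihilators_of_mpoly_iff:
  "map_poly mfps_of_mpoly A \<in> annihilators f \<longleftrightarrow> A \<noteq> 0 \<and> annihilates A f"
proof -
  have "map_poly mfps_of_mpoly A = 0 \<longleftrightarrow> A = 0"
    by (auto simp: poly_eq_iff coeff_map_poly mfps_of_mpoly_eq_0_iff)
  moreover have "map_poly mfps_of_mpoly A \<in> polys_over mpolys"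
    by (simp add: polys_over_def coeff_map_poly mfps_of_mpoly_mpolys)
  ultimately show ?thesis
    by (simp add: annihilators_def annihilates_def)
qed

lemma poly_support_of_mpoly: "poly_support (map_poly mfps_of_mpoly A) = t_exponents A"
proof -
  have "Poly_Mapping.keys (Polynomial.coeff A j) = {}" if "\<not> j \<le> Polynomial.degree A" for j
    using that by (simp add: coeff_eq_0)
  then show ?thesis
    by (fastforce simp: poly_support_def t_exponents_def coeff_map_poly mfps_support_of_mpoly)
qed

text \<open>The height for the weight \<open>w\<close> is attained by some \<open>A\<close> of its
  own, but \<open>E\<close> divides this \<open>A\<close>, so its weights stay below those of
  \<open>A\<close>. With \<open>w\<close> a coordinate or the coordinate sum, one \<open>E\<close>
  obeys all heights.\<close>

lemma poly_support_le_height: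
  fixes f :: "('a::field, 'n::finite) mfps" and w :: "nat ^ 'n \<Rightarrow> nat"
  assumes add: "\<And>i j. w (i + j) = w i + w j"
    and E: "E \<in> annihilators f"
    and dvd: "\<And>A. A \<in> annihilators f \<Longrightarrow> \<exists>B\<in>polys_over mpolys. A = E * B"
    and i: "i \<in> poly_support E"
  shows "w i \<le> (LEAST m. \<exists>A. A \<noteq> 0 \<and> annihilates A f \<and> Max (w ` t_exponents A) = m)"
    (is "_ \<le> ?h")
proof -
  have E_props: "E \<in> polys_over mpolys"
    using E by (simp add: annihilators_def)
  from E_props obtain E' where "map_poly mfps_of_mpoly E' = E"
    by (rule polys_over_mpolys_of_mpoly)
  then have "\<exists>m. \<exists>A. A \<noteq> 0 \<and> annihilates A f \<and> Max (w ` t_exponents A) = m"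
    using E annihilators_of_mpoly_iff by blast
  from LeastI_ex[OF this] obtain A where A: "A \<noteq> 0" "annihilates A f" "Max (w ` t_exponents A) = ?h"
    by blast
  then have A': "map_poly mfps_of_mpoly A \<in> annihilators f"
    by (simp add: annihilators_of_mpoly_iff)
  then obtain B where B: "B \<in> polys_over mpolys" "map_poly mfps_of_mpoly A = E * B"
    using dvd by blast
  have "finite (t_exponents A)" by (simp add: t_exponents_def)
  then have "w j \<le> ?h" if "j \<in> poly_support (E * B)" for j
    using that unfolding B(2)[symmetric] poly_support_of_mpoly A(3)[symmetric] by (intro Max_ge) auto
  moreover have "E * B \<noteq> 0"
    using A' by (simp add: B(2) annihilators_def)
  ultimately show ?thesis
    using poly_support_factor_le[of w, OF add E_props B(1) _ _ i] by blast
qed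

section \<open>From the degree to an annihilating polynomial\<close>

lemma ratfuns_altdef:
  "(ratfuns :: ('a::field, 'n::finite) mfps fract set) = {Fract u v | u v. u \<in> mpolys \<and> v \<in> mpolys \<and> v \<noteq> 0}"
proof (intro equalityI subsetI)
  fix x :: "('a, 'n) mfps fract"
  assume "x \<in> ratfuns"
  then show "x \<in> {Fract u v | u v. u \<in> mpolys \<and> v \<in> mpolys \<and> v \<noteq> 0}"
    unfolding ratfuns_def using mfps_of_mpoly_mpolys mfps_of_mpoly_eq_0_iff by fast
next
  fix x :: "('a, 'n) mfps fract"
  assume "x \<in> {Fract u v | u v. u \<in> mpolys \<and> v \<in> mpolys \<and> v \<noteq> 0}"
  then obtain u v where x: "x = Fract u v" "u \<in> mpolys" "v \<in> mpolys" "v \<noteq> 0" by blast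
  from x(2) obtain p where p: "mfps_of_mpoly p = u" by (rule mpolys_of_mpoly)
  from x(3) obtain r where r: "mfps_of_mpoly r = v" by (rule mpolys_of_mpoly)
  have "x = Fract (mfps_of_mpoly p) (mfps_of_mpoly r)" "r \<noteq> 0"
    using x p r by auto
  then show "x \<in> ratfuns" unfolding ratfuns_def by blast
qed

lemma field_mfps_field: "field mfps_field"
  unfolding mfps_field_def by (rule field_from_type_algebra)

lemma mfps_field_simps [simp]:
  "carrier mfps_field = UNIV" "x \<otimes>\<^bsub>mfps_field\<^esub> y = x * y" "x \<oplus>\<^bsub>mfps_field\<^esub> y = x + y"
  "\<one>\<^bsub>mfps_field\<^esub> = 1" "\<zero>\<^bsub>mfps_field\<^esub> = 0"
  by (simp_all add: mfps_field_def ring_of_type_algebra_def)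

lemma mfps_field_pow [simp]: "x [^]\<^bsub>mfps_field\<^esub> (m::nat) = x ^ m"
  by (induction m) (simp_all add: nat_pow_def mult.commute)

lemma subfield_ratfuns: "subfield (ratfuns :: ('a::field, 'n::finite) mfps fract set) mfps_field"
proof -
  interpret F: field "mfps_field :: ('a, 'n) mfps fract ring"
    by (rule field_mfps_field)
  interpret R: subdomain "mpolys :: ('a, 'n) mfps set"
    by (rule subdomain_mfps_polys)
  have minus: "\<ominus>\<^bsub>mfps_field\<^esub> x = - x" for x :: "('a, 'n) mfps fract"
    using F.minus_equality[of "- x" x] by simp
  have ratI: "Fract u v \<in> ratfuns" if "u \<in> mpolys" "v \<in> mpolys" "v \<noteq> 0" for u v :: "('a, 'n) mfps"
    using that by (auto simp: ratfuns_altdef)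
  have ratE: "\<exists>u v. x = Fract u v \<and> u \<in> mpolys \<and> v \<in> mpolys \<and> v \<noteq> 0" if "x \<in> ratfuns"
    for x :: "('a, 'n) mfps fract"
    using that by (auto simp: ratfuns_altdef)
  show ?thesis
  proof (rule F.subfieldI'[OF F.subringI])
    show "\<one>\<^bsub>mfps_field\<^esub> \<in> (ratfuns :: ('a, 'n) mfps fract set)"
      using ratI[of 1 1] by (simp add: One_fract_def)
    fix x :: "('a, 'n) mfps fract"
    assume "x \<in> ratfuns"
    then obtain u v where x: "x = Fract u v" "u \<in> mpolys" "v \<in> mpolys" "v \<noteq> 0"
      using ratE by blast
    show "\<ominus>\<^bsub>mfps_field\<^esub> x \<in> ratfuns"
      using x ratI[of "- u" v] by (simp add: minus)
    fix y :: "('a, 'n) mfps fract"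
    assume "y \<in> ratfuns"
    then obtain u' v' where y: "y = Fract u' v'" "u' \<in> mpolys" "v' \<in> mpolys" "v' \<noteq> 0"
      using ratE by blast
    show "x \<otimes>\<^bsub>mfps_field\<^esub> y \<in> ratfuns" "x \<oplus>\<^bsub>mfps_field\<^esub> y \<in> ratfuns"
      using x y by (auto intro!: ratI)
  next
    fix x :: "('a, 'n) mfps fract"
    assume "x \<in> ratfuns - {\<zero>\<^bsub>mfps_field\<^esub>}"
    then have "x \<in> ratfuns" "x \<noteq> 0" by auto
    then obtain u v where x: "x = Fract u v" "u \<in> mpolys" "v \<in> mpolys" "v \<noteq> 0" "x \<noteq> 0"
      using ratE[of x] by blast
    then have "u \<noteq> 0" by (auto simp: fract_collapse)
    then have "x * Fract v u = 1"
      using x by (simp add: One_fract_def eq_fract mult.commute)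
    then have "inv\<^bsub>mfps_field\<^esub> x = Fract v u"
      by (intro F.comm_inv_char) auto
    then show "inv\<^bsub>mfps_field\<^esub> x \<in> ratfuns"
      using x \<open>u \<noteq> 0\<close> by (simp add: ratI)
  qed auto
qed

text \<open>For algebraic \<open>f\<close> the generated field is the simple extension, whose
  dimension is the degree of the minimal polynomial. \<open>Irr\<close> is a list of coefficients,
  one more than the degree.\<close>

lemma mfps_degree_eq_degree_Irr:
  fixes f :: "('a::field, 'n::finite) mfps"
  assumes "mfps_algebraic f"
  shows "mfps_degree f = length (ring.Irr mfps_field ratfuns (Fract f 1)) - 1"
proof -
  interpret F: field "mfps_field :: ('a, 'n) mfps fract ring"
    by (rule field_mfps_field)
  let ?x = "Fract f 1"
  have alg: "(F.algebraic over ratfuns) ?x"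
    using assms by (simp add: mfps_algebraic_def over_def)
  have sub: "subfield (F.simple_extension ratfuns ?x) mfps_field"
    using F.simple_extension_is_subfield[OF subfield_ratfuns] alg by simp
  have sub': "subfield (generate_field mfps_field (insert ?x ratfuns)) mfps_field"
    by (rule F.generate_field_is_subfield) simp
  have "generate_field mfps_field (insert ?x ratfuns) = F.simple_extension ratfuns ?x"
  proof (rule equalityI)
    show "generate_field mfps_field (insert ?x ratfuns) \<subseteq> F.simple_extension ratfuns ?x"
      using F.simple_extension_incl[of ratfuns ?x]
        F.simple_extension_mem[OF subfieldE(1)[OF subfield_ratfuns], of ?x]
      by (intro F.generate_field_min_subfield1[OF _ sub]) auto
    show "F.simple_extension ratfuns ?x \<subseteq> generate_field mfps_field (insert ?x ratfuns)"
      by (rule F.simple_extension_subring_incl[OF subfieldE(1)[OF sub']])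
        (auto intro: generate_field.incl)
  qed
  moreover have "F.dimension (length (F.Irr ratfuns ?x) - 1) ratfuns (F.simple_extension ratfuns ?x)"
    using F.dimension_simple_extension[OF subfield_ratfuns _ alg] by simp
  then have "F.dim ratfuns (F.simple_extension ratfuns ?x) = length (F.Irr ratfuns ?x) - 1"
    using F.dimI[OF subfield_ratfuns] by (simp add: over_def)
  ultimately show ?thesis by (simp add: mfps_degree_def)
qed

text \<open>In \<open>xs\<close> the highest coefficient comes first, so \<open>hd xs\<close>
  belongs to the index \<open>length xs - 1\<close>. The conjuncts serve to bound the degree of
  \<open>B\<close>, to see \<open>B\<close> nonzero when \<open>xs\<close> is monic, and to transfer
  a root.\<close>

lemma clear_denominators:
  fixes xs :: "('a::field, 'n::finite) mfps fract list"
  assumes "set xs \<subseteq> ratfuns"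
  shows "\<exists>D\<in>mpolys. \<exists>B\<in>polys_over mpolys. D \<noteq> 0 \<and> (\<forall>j\<ge>length xs. Polynomial.coeff B j = 0) \<and>
    (xs \<noteq> [] \<longrightarrow> Fract (Polynomial.coeff B (length xs - 1)) 1 = Fract D 1 * hd xs) \<and>
    (\<forall>g. Fract (poly B g) 1 = Fract D 1 * ring.eval mfps_field xs (Fract g 1))"
  using assms
proof (induction xs)
  interpret F: field "mfps_field :: ('a, 'n) mfps fract ring"
    by (rule field_mfps_field)
  interpret R: subdomain "mpolys :: ('a, 'n) mfps set"
    by (rule subdomain_mfps_polys)
  interpret P: subdomain "polys_over mpolys :: ('a, 'n) mfps poly set"
    by (rule R.subdomain_polys_over)
  {
    case Nil
    show ?case
      by (intro bexI[of _ 1] bexI[of _ 0]) (auto simp: fract_collapse)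
  next
    case (Cons x xs)
    then obtain D B where *: "D \<in> mpolys" "B \<in> polys_over mpolys" "D \<noteq> 0"
      "\<And>j. j \<ge> length xs \<Longrightarrow> Polynomial.coeff B j = 0"
      "\<And>g. Fract (poly B g) 1 = Fract D 1 * F.eval xs (Fract g 1)"
      by auto
    obtain u v where x: "x = Fract u v" "u \<in> mpolys" "v \<in> mpolys" "v \<noteq> 0"
      using Cons.prems by (auto simp: ratfuns_altdef)
    \<comment> \<open>The new head \<open>x = u / v\<close> has degree \<open>length xs\<close>. The
      common denominator becomes \<open>D * v\<close>, so the old part is scaled by \<open>v\<close>
      and \<open>x\<close> turns into \<open>D * u\<close>.\<close>
    define B' where "B' = [:v:] * B + Polynomial.monom (D * u) (length xs)"
    have pow: "Fract g 1 ^ m = Fract (g ^ m) 1" for g :: "('a, 'n) mfps" and m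
      by (induction m) (simp_all add: One_fract_def)
    have Dux: "Fract (D * u) 1 = Fract (D * v) 1 * x"
      using x(4) by (simp add: x(1) eq_fract mult_ac)
    have "Fract (poly B' g) 1 = Fract (D * v) 1 * F.eval (x # xs) (Fract g 1)" for g
    proof -
      have "Fract (poly B' g) 1 = Fract v 1 * Fract (poly B g) 1 + Fract (D * u) 1 * Fract (g ^ length xs) 1"
        by (simp add: B'_def poly_monom)
      also have "\<dots> = Fract (D * v) 1 * F.eval xs (Fract g 1) + Fract (D * v) 1 * x * Fract g 1 ^ length xs"
        unfolding *(5) Dux pow by (simp add: mult_ac flip: mult.assoc)
      also have "\<dots> = Fract (D * v) 1 * F.eval (x # xs) (Fract g 1)"
        by (simp add: algebra_simps)
      finally show ?thesis .
    qed
    moreover have "B' \<in> polys_over mpolys"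
      unfolding B'_def using * x
      by (intro P.add_closed P.mult_closed R.const_polys_over R.monom_polys_over R.mult_closed)
    moreover have "Polynomial.coeff B' j = (if j = length xs then D * u else v * Polynomial.coeff B j)"
      for j
      using *(4)[OF order_refl] by (simp add: B'_def coeff_monom)
    moreover have "D * v \<in> mpolys" "D * v \<noteq> 0"
      using * x by auto
    ultimately show ?case
      using Dux *(4) by (intro bexI[of _ "D * v"] bexI[of _ B']) auto
  }
qed

text \<open>The minimal polynomial over the rational functions, cleared of denominators. It bounds
  the \<open>y\<close>-degree of a minimal annihilator by the degree of \<open>f\<close>.\<close>

lemma annihilator_of_degree:
  fixes f :: "('a::field, 'n::finite) mfps"
  assumes "mfps_algebraic f"
  shows "\<exists>B\<in>annihilators f. Polynomial.degree B \<le> mfps_degree f"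
proof -
  interpret F: field "mfps_field :: ('a, 'n) mfps fract ring"
    by (rule field_mfps_field)
  define p where "p = F.Irr ratfuns (Fract f 1)"
  have alg: "(F.algebraic over ratfuns) (Fract f 1)"
    using assms by (simp add: mfps_algebraic_def over_def)
  note Irr = F.IrrE[OF subfield_ratfuns _ alg, folded p_def, simplified]
  have "p \<noteq> []"
    using Irr(2) by (auto simp: ring_irreducible_def univ_poly_zero)
  moreover have p: "hd p = 1" "F.eval p (Fract f 1) = 0"
    using Irr(3,4) by auto
  moreover have "set p \<subseteq> ratfuns"
    using Irr(1) by (auto simp: univ_poly_carrier[symmetric] polynomial_def)
  ultimately obtain D B where *: "B \<in> polys_over mpolys" "D \<noteq> 0"
    "\<And>j. j \<ge> length p \<Longrightarrow> Polynomial.coeff B j = 0"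
    "Fract (Polynomial.coeff B (length p - 1)) 1 = Fract D 1" "Fract (poly B f) 1 = 0"
    using clear_denominators[of p] by auto
  have "poly B f = 0"
    using *(5) by (simp add: Zero_fract_def eq_fract)
  moreover have "B \<noteq> 0"
    using *(2,4) by (auto simp: eq_fract)
  moreover have "Polynomial.degree B \<le> length p - 1"
    using *(3) by (intro degree_le) auto
  ultimately show ?thesis
    using *(1) mfps_degree_eq_degree_Irr[OF assms] by (auto simp: annihilators_def p_def)
qed

section \<open>Spaces of residues\<close>

text \<open>The quotients \<open>P(f) / G(f)\<close> that are power series, with the denominator
  multiplied out. If \<open>E = (y - f) G\<close>, then \<open>G(f)\<close> is
  \<open>E_y(f)\<close>.\<close>

definition residues :: "('a::field, 'n::finite) mfps \<Rightarrow> ('a, 'n) mfps poly \<Rightarrow> nat \<Rightarrow> (nat ^ 'n) set \<Rightarrow> ('a, 'n) mfps set" where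
  "residues f G m Q = {g. \<exists>P\<in>bounded_polys m Q. g * poly G f = poly P f}"

lemma card_residues_le:
  fixes f :: "('a::{field, finite}, 'n::finite) mfps"
  assumes "finite Q" "poly G f \<noteq> 0"
  shows "finite (residues f G m Q)" "card (residues f G m Q) \<le> CARD('a) ^ (m * card Q)"
proof -
  define \<rho> where "\<rho> = (\<lambda>P. SOME g. g * poly G f = poly P f)"
  have sub: "residues f G m Q \<subseteq> \<rho> ` bounded_polys m Q"
  proof
    fix g assume "g \<in> residues f G m Q"
    then obtain P where P: "P \<in> bounded_polys m Q" "g * poly G f = poly P f"
      by (auto simp: residues_def)
    have "\<rho> P * poly G f = poly P f"
      unfolding \<rho>_def using P(2) by (rule someI)
    then have "\<rho> P = g" using P(2) assms(2) by (metis mult_right_cancel)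
    then show "g \<in> \<rho> ` bounded_polys m Q" using P(1) by blast
  qed
  have fin: "finite (\<rho> ` bounded_polys m Q)"
    using card_bounded_polys(1)[OF assms(1)] by blast
  show "finite (residues f G m Q)"
    using sub fin by (rule finite_subset)
  have "card (residues f G m Q) \<le> card (\<rho> ` bounded_polys m Q)"
    using fin sub by (rule card_mono)
  also have "\<dots> \<le> card (bounded_polys m Q :: ('a, 'n) mfps poly set)"
    by (rule card_image_le[OF card_bounded_polys(1)[OF assms(1)]])
  also have "\<dots> \<le> CARD('a) ^ (m * card Q)"
    by (rule card_bounded_polys(2)[OF assms(1)])
  finally show "card (residues f G m Q) \<le> CARD('a) ^ (m * card Q)" .
qed

lemma residues_linear:
  shows "0 \<in> residues f G m Q"
    and "x \<in> residues f G m Q \<Longrightarrow> y \<in> residues f G m Q \<Longrightarrow> x + y \<in> residues f G m Q"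
    and "x \<in> residues f G m Q \<Longrightarrow> mfps_term c 0 * x \<in> residues f G m Q"
proof -
  have "0 \<in> bounded_polys m Q" by (simp add: bounded_polys_def poly_support_empty_iff[THEN iffD2])
  then show "0 \<in> residues f G m Q"
    unfolding residues_def by (auto intro!: bexI[of _ 0])
next
  assume "x \<in> residues f G m Q" "y \<in> residues f G m Q"
  then obtain P R where PR: "P \<in> bounded_polys m Q" "x * poly G f = poly P f"
    "R \<in> bounded_polys m Q" "y * poly G f = poly R f" by (auto simp: residues_def)
  have "poly_support (P + R) \<subseteq> poly_support P \<union> poly_support R"
    using mfps_support_add_subset by (fastforce simp: poly_support_def)
  then have "P + R \<in> bounded_polys m Q"
    using PR(1,3) unfolding bounded_polys_def by auto
  moreover have "(x + y) * poly G f = poly (P + R) f"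
    using PR(2,4) by (simp add: distrib_right)
  ultimately show "x + y \<in> residues f G m Q"
    unfolding residues_def by blast
next
  assume "x \<in> residues f G m Q"
  then obtain P where P: "P \<in> bounded_polys m Q" "x * poly G f = poly P f"
    by (auto simp: residues_def)
  have "poly_support (smult (mfps_term c 0) P) \<subseteq> poly_support P"
    by (auto simp: poly_support_def mfps_support_iff mfps_nth_term_mult)
  then have "smult (mfps_term c 0) P \<in> bounded_polys m Q"
    using P(1) unfolding bounded_polys_def by auto
  moreover have "mfps_term c 0 * x * poly G f = poly (smult (mfps_term c 0) P) f"
    using P(2) by (simp add: mult.assoc)
  ultimately show "mfps_term c 0 * x \<in> residues f G m Q"
    unfolding residues_def by blast
qed

text \<open>Numerators of degree up to \<open>d = degree E\<close> go to numerators of degree below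
  \<open>d\<close>: the degree of \<open>P * E ^ (q - 1)\<close> is at most \<open>q * d\<close>,
  and an index \<open>j \<ge> d\<close> would read the coefficient at \<open>q * j + q - 1\<close>,
  which is larger because \<open>q \<ge> 2\<close>.\<close>

lemma section_residues:
  fixes f :: "('a::{field, finite}, 'n::finite) mfps"
  assumes E: "E = [:- f, 1:] * G" and suppE: "poly_support E \<subseteq> exponent_region ht h"
    and r: "r \<in> digit_vectors CARD('a)"
    and g: "g \<in> residues f G (Suc (Polynomial.degree E)) (exponent_region ht h)"
  shows "mfps_section CARD('a) r g \<in> residues f G (Polynomial.degree E) (exponent_region ht h)"
proof -
  let ?q = "CARD('a)" and ?d = "Polynomial.degree E"
  have q: "?q \<ge> 2"
    using card_mono[of "UNIV :: 'a set" "{0, 1}"] by simp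
  obtain P where P: "P \<in> bounded_polys (Suc ?d) (exponent_region ht h)" "g * poly G f = poly P f"
    using g by (auto simp: residues_def)
  define P' where "P' = poly_section ?q r (P * E ^ (?q - 1))"
  have suppP: "poly_support P \<subseteq> exponent_region ht h" using P(1) by (simp add: bounded_polys_def)
  have "poly_support P' \<subseteq> exponent_region ht h"
  proof
    fix i assume i: "i \<in> poly_support P'"
    have "i $ k \<le> ht k" for k
    proof (rule poly_support_section_le[where w = "\<lambda>i. i $ k"])
      show "i \<in> poly_support (poly_section ?q r (P * E ^ (?q - 1)))"
        using i by (simp add: P'_def)
    qed (use suppE suppP q in \<open>auto simp: exponent_region_def\<close>)
    moreover have "(\<Sum>k\<in>UNIV. i $ k) \<le> h"
    proof (rule poly_support_section_le[where w = "\<lambda>i. \<Sum>k\<in>UNIV. i $ k"])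
      show "i \<in> poly_support (poly_section ?q r (P * E ^ (?q - 1)))"
        using i by (simp add: P'_def)
    qed (use suppE suppP q in \<open>auto simp: exponent_region_def sum.distrib\<close>)
    ultimately show "i \<in> exponent_region ht h" by (simp add: exponent_region_def)
  qed
  moreover have "Polynomial.coeff P' j = 0" if "j \<ge> ?d" for j
  proof -
    have "Polynomial.degree P \<le> ?d"
      using P(1) by (intro degree_le) (auto simp: bounded_polys_def)
    moreover have "Polynomial.degree (E ^ (?q - 1)) \<le> ?d * (?q - 1)"
      by (rule degree_power_le)
    ultimately have "Polynomial.degree (P * E ^ (?q - 1)) \<le> ?d + ?d * (?q - 1)"
      using degree_mult_le[of P "E ^ (?q - 1)"] by linarith
    also have "\<dots> = ?q * ?d" using q by (cases ?q) auto
    also have "\<dots> < ?q * j + ?q - 1"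
      using mult_le_mono2[OF that, of ?q] q by linarith
    finally show ?thesis
      using q by (simp add: P'_def coeff_poly_section coeff_eq_0)
  qed
  ultimately have "P' \<in> bounded_polys ?d (exponent_region ht h)"
    by (simp add: bounded_polys_def)
  moreover have "mfps_section ?q r g * poly G f = poly P' f"
    unfolding P'_def by (rule section_residue[OF r E P(2)])
  ultimately show ?thesis by (auto simp: residues_def)
qed

theorem theorem4p1:
  fixes f :: "('a::{field,finite}, 'n::finite) mfps"
    and a :: "nat ^ 'n \<Rightarrow> 'a"
    and q n d h N N' :: nat
    and ht :: "'n \<Rightarrow> nat"
  assumes "q = CARD('a)"
    and "n = CARD('n)"
    and "mfps_algebraic f"
    and "d = mfps_degree f"
    and "h = total_height f"
    and "\<And>k. ht k = partial_height k f"
    and "a = mfps_nth f"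
    and "N = d * min (\<Prod>k\<in>UNIV. ht k + 1) ((n + h) choose n)"
    and "N' = (d + 1) * min (\<Prod>k\<in>UNIV. ht k + 1) ((n + h) choose n)"
  shows "comp_reverse q a \<le> enat (1 + q ^ N) \<and> comp_direct q a \<le> enat (q ^ N')"
proof -
  obtain B where B: "B \<in> annihilators f" "Polynomial.degree B \<le> d"
    using annihilator_of_degree assms(3,4) by blast
  then have "annihilators f \<noteq> {}" by blast
  then obtain E where E: "E \<in> annihilators f"
    and E_min: "\<And>A. A \<in> annihilators f \<Longrightarrow> Polynomial.degree E \<le> Polynomial.degree A"
    and E_dvd: "\<And>A. A \<in> annihilators f \<Longrightarrow> \<exists>B\<in>polys_over mpolys. A = E * B"
    using exists_minimal_annihilator by blast
  let ?Q = "exponent_region ht h" and ?d = "Polynomial.degree E"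
  have deg: "?d \<le> d" using E_min[OF B(1)] B(2) by simp
  have suppE: "poly_support E \<subseteq> ?Q"
  proof
    fix i assume i: "i \<in> poly_support E"
    have "i $ k \<le> ht k" for k
      unfolding assms(6) partial_height_def t_degree_def
      by (rule poly_support_le_height[OF _ E E_dvd i]) simp_all
    moreover have "(\<Sum>k\<in>UNIV. i $ k) \<le> h"
      unfolding assms(5) total_height_def t_total_degree_def
      by (rule poly_support_le_height[OF _ E E_dvd i]) (simp_all add: sum.distrib)
    ultimately show "i \<in> ?Q" by (simp add: exponent_region_def)
  qed
  have "poly E f = 0" using E by (simp add: annihilators_def)
  then obtain G where G: "E = [:- f, 1:] * G"
    unfolding poly_eq_0_iff_dvd by (elim dvdE)
  \<comment> \<open>\<open>E_y = G + (y - f) G_y\<close> by the product rule, and only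
    \<open>G\<close> survives at \<open>y = f\<close>.\<close>
  have pd: "poly (pderiv E) f = poly G f"
    by (simp add: G pderiv_mult pderiv_pCons del: mult_pCons_left)
  then have Gf: "poly G f \<noteq> 0"
    using pderiv_minimal_annihilator[OF E E_min] by simp
  define W where "W = (\<lambda>m. residues f G m ?Q)"
  note finQ = card_exponent_region(1)[of ht h]
  have q: "q \<ge> 1" using assms(1) by (simp add: card_gt_0_iff Suc_le_eq)
  have sec: "mfps_section q r g \<in> W ?d" if "g \<in> W (Suc ?d)" "r \<in> digit_vectors q" for g r
    using section_residues[OF G suppE] that by (simp add: W_def assms(1))
  have mono: "W ?d \<subseteq> W (Suc ?d)"
  proof -
    have "bounded_polys ?d ?Q \<subseteq> (bounded_polys (Suc ?d) ?Q :: ('a, 'n) mfps poly set)"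
      by (auto simp: bounded_polys_def)
    then show ?thesis unfolding W_def residues_def by blast
  qed
  \<comment> \<open>The numerator is \<open>y E_y\<close>, written
    \<open>pCons 0 (pderiv E)\<close>. Its coefficients are integer multiples of those of
    \<open>E\<close>, so its exponents stay in the region, while its degree may reach that of
    \<open>E\<close>; hence \<open>Suc\<close>.\<close>
  have f_W: "f \<in> W (Suc ?d)"
  proof -
    have coeff: "Polynomial.coeff (pCons 0 (pderiv E)) j = of_nat j * Polynomial.coeff E j" for j
      by (cases j) (simp_all add: coeff_pderiv)
    have "poly_support (pCons 0 (pderiv E)) \<subseteq> poly_support E"
      by (auto simp: poly_support_def coeff mfps_support_iff of_nat_mfps mfps_nth_term_mult)
    then have "pCons 0 (pderiv E) \<in> bounded_polys (Suc ?d) ?Q"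
      using suppE by (auto simp: bounded_polys_def coeff coeff_eq_0)
    then show ?thesis
      by (auto simp: W_def residues_def pd intro!: bexI[of _ "pCons 0 (pderiv E)"])
  qed
  have card_W: "finite (W m)" "card (W m) \<le> q ^ (m * card ?Q)" for m
    using card_residues_le[OF finQ Gf] by (auto simp: W_def assms(1))
  have card_Q: "card ?Q \<le> min (\<Prod>k\<in>UNIV. ht k + 1) ((n + h) choose n)"
    using card_exponent_region(2)[of ht h] by (simp add: assms(2))
  \<comment> \<open>One section already takes \<open>f\<close> into the smaller space, so only
    \<open>f\<close> itself needs an additional state.\<close>
  have "comp_reverse q a \<le> enat (card (insert f (W ?d)))"
    unfolding assms(7)
  proof (rule comp_reverse_le)
    show "mfps_section q r g \<in> insert f (W ?d)"
      if "g \<in> insert f (W ?d)" "r \<in> digit_vectors q" for g r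
      using that sec f_W mono by blast
  qed (use q card_W in auto)
  also have "card (insert f (W ?d)) \<le> 1 + q ^ N"
  proof -
    have "?d * card ?Q \<le> N"
      unfolding assms(8) using deg card_Q by (rule mult_le_mono)
    then have "card (W ?d) \<le> q ^ N"
      using card_W(2)[of ?d] power_increasing[OF _ q] by (meson le_trans)
    then show ?thesis
      using card_insert_le_m1 card_W(1)[of ?d] by (simp add: card_insert_if)
  qed
  finally have rev: "comp_reverse q a \<le> enat (1 + q ^ N)" by simp
  \<comment> \<open>Here adding \<open>f\<close> as a single element would destroy linearity, so the
    larger space is used.\<close>
  have "comp_direct q a \<le> enat (card (W (Suc ?d)))"
    unfolding assms(7)
  proof (rule comp_direct_le)
    show "mfps_section q r g \<in> W (Suc ?d)" if "g \<in> W (Suc ?d)" "r \<in> digit_vectors q" for g r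
      using sec[OF that] mono by blast
  qed (use q card_W f_W residues_linear in \<open>auto simp: W_def\<close>)
  also have "card (W (Suc ?d)) \<le> q ^ N'"
  proof -
    have "Suc ?d * card ?Q \<le> N'"
      unfolding assms(9) using deg card_Q by (intro mult_le_mono) simp_all
    then show ?thesis
      using card_W(2)[of "Suc ?d"] power_increasing[OF _ q] by (meson le_trans)
  qed
  finally show ?thesis using rev by simp
qed

end
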